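(* Let $\mathcal A\subseteq U_qL\mathfrak g$ be a modified nilpotent subalgebra, i.e. a subalgebra generated by elements $\tilde F_i=F_i+E_i'$ ($i\in\hat I$) with $E_i'\in\hat U^{\ge0}$. Let $V\in\mathrm{Rep}_{\rm fd}(U_qL\mathfrak g)$ be irreducible. Then $V(z)$ remains irreducible under restriction to $\mathcal A(z)=\mathcal A\otimes\mathbb F(z)$.
   Context: $\mathfrak g$ is a finite-dimensional complex simple Lie algebra with vertex set $I$, $\hat I=\{0\}\cup I$ the vertex set of the untwisted affine Dynkin diagram with extended Cartan matrix $(a_{ij})_{i,j\in\hat I}$, $d_i$ symmetrizing positive integers, $q_i=q^{d_i}$, $\mathbb F=\overline{\mathbb C(q)}$, and $\delta=\sum_ia_i\alpha_i$ with $a_0=1$. The quantum loop algebra $U_qL\mathfrak g$ is the $\mathbb F$-algebra generated by $E_i,F_i,K_i^{\pm1}$ ($i\in\hat I$) with relations $K_iK_i^{-1}=1$, $K_iK_j=K_jK_i$, $K_iE_jK_i^{-1}=q_i^{a_{ij}}E_j$, $K_iF_jK_i^{-1}=q_i^{-a_{ij}}F_j$, $[E_i,F_j]=\delta_{ij}(K_i-K_i^{-1})/(q_i-q_i^{-1})$, the quantum Serre relations, and $\prod_iK_i^{a_i}=1$. $\hat U^+,\hat U^0,\hat U^-$ are the subalgebras generated by all $E_i$, all $K_i^{\pm1}$, all $F_i$ respectively, and $\hat U^{\ge0}=\hat U^+\hat U^0$. $\mathrm{Rep}_{\rm fd}(U_qL\mathfrak g)$ denotes finite-dimensional representations on which the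 $K_i$ act semisimply with eigenvalues in $q^{\mathbb Z}$. The principal grading shift $\Sigma_z$ is the automorphism of $U_qL\mathfrak g\otimes\mathbb F[z^{\pm1}]$ with $\Sigma_z(K_i^{\pm1})=K_i^{\pm1}$, $\Sigma_z(E_i)=zE_i$, $\Sigma_z(F_i)=z^{-1}F_i$ for all $i\in\hat I$; $V(z)=V\otimes\mathbb F(z)$ with $x$ acting by $\pi_V(\Sigma_z(x))$. *)

theory Defs
  imports "Jordan_Normal_Form.Matrix" "HOL-Computational_Algebra.Polynomial"
          "HOL-Computational_Algebra.Fraction_Field"
begin

definition is_alg_closure_of_Cq :: "(complex \<Rightarrow> 'k::field) \<Rightarrow> 'k \<Rightarrow> bool" where
  "is_alg_closure_of_Cq \<iota> q \<longleftrightarrow>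
     \<iota> 1 = 1 \<and> (\<forall>x y. \<iota> (x + y) = \<iota> x + \<iota> y) \<and> (\<forall>x y. \<iota> (x * y) = \<iota> x * \<iota> y) \<and>
     (\<forall>p :: complex poly. p \<noteq> 0 \<longrightarrow> poly (map_poly \<iota> p) q \<noteq> 0) \<and>
     (\<forall>x :: 'k. \<exists>P :: complex poly poly. P \<noteq> 0 \<and>
        (\<Sum>i\<le>degree P. poly (map_poly \<iota> (coeff P i)) q * x ^ i) = 0) \<and>
     (\<forall>p :: 'k poly. degree p > 0 \<longrightarrow> (\<exists>x. poly p x = 0))"

text \<open>Indices: I = {1..n}, \<open>\<hat>I\<close> = {0..n}.  Matrices are functions nat => nat => int.\<close>

definition is_GCM_on :: "nat set \<Rightarrow> (nat \<Rightarrow> nat \<Rightarrow> int) \<Rightarrow> bool" where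
  "is_GCM_on J A \<longleftrightarrow> (\<forall>i\<in>J. A i i = 2) \<and> (\<forall>i\<in>J. \<forall>j\<in>J. i \<noteq> j \<longrightarrow> A i j \<le> 0) \<and>
     (\<forall>i\<in>J. \<forall>j\<in>J. A i j = 0 \<longleftrightarrow> A j i = 0)"

definition symmetrizes :: "nat set \<Rightarrow> (nat \<Rightarrow> nat \<Rightarrow> int) \<Rightarrow> (nat \<Rightarrow> nat) \<Rightarrow> bool" where
  "symmetrizes J A d \<longleftrightarrow> (\<forall>i\<in>J. d i > 0) \<and>
     (\<forall>i\<in>J. \<forall>j\<in>J. int (d i) * A i j = int (d j) * A j i)"

definition indecomposable_on :: "nat set \<Rightarrow> (nat \<Rightarrow> nat \<Rightarrow> int) \<Rightarrow> bool" where
  "indecomposable_on J A \<longleftrightarrow>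
     (\<forall>S. S \<subseteq> J \<and> S \<noteq> {} \<and> S \<noteq> J \<longrightarrow> (\<exists>i\<in>S. \<exists>j\<in>J - S. A i j \<noteq> 0))"

text \<open>Cartan matrix of a finite-dimensional complex simple Lie algebra with vertex set
  {1..n}: an indecomposable generalized Cartan matrix of finite type (symmetrizable with
  positive definite symmetrization).\<close>
definition simple_cartan_matrix :: "nat \<Rightarrow> (nat \<Rightarrow> nat \<Rightarrow> int) \<Rightarrow> bool" where
  "simple_cartan_matrix n A \<longleftrightarrow> n \<ge> 1 \<and> is_GCM_on {1..n} A \<and> indecomposable_on {1..n} A \<and>
     (\<exists>d. symmetrizes {1..n} A d \<and>
        (\<forall>x :: nat \<Rightarrow> real. (\<exists>i\<in>{1..n}. x i \<noteq> 0) \<longrightarrow>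
           (\<Sum>i\<in>{1..n}. \<Sum>j\<in>{1..n}. x i * real (d i) * real_of_int (A i j) * x j) > 0))"

text \<open>Simple reflection on the root lattice (vectors nat => int supported on {1..n}):
  s_i(beta) = beta - <alpha_i^vee, beta> alpha_i, with <alpha_i^vee, alpha_k> = a_ik.\<close>
definition simple_refl :: "nat \<Rightarrow> (nat \<Rightarrow> nat \<Rightarrow> int) \<Rightarrow> nat \<Rightarrow> (nat \<Rightarrow> int) \<Rightarrow> (nat \<Rightarrow> int)" where
  "simple_refl n A i \<beta> = (\<lambda>j. if j = i then \<beta> j - (\<Sum>k\<in>{1..n}. A i k * \<beta> k) else \<beta> j)"

inductive_set roots_of :: "nat \<Rightarrow> (nat \<Rightarrow> nat \<Rightarrow> int) \<Rightarrow> (nat \<Rightarrow> int) set"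
  for n A where
  simple: "i \<in> {1..n} \<Longrightarrow> (\<lambda>j. if j = i then 1 else 0) \<in> roots_of n A"
| refl: "\<beta> \<in> roots_of n A \<Longrightarrow> i \<in> {1..n} \<Longrightarrow> simple_refl n A i \<beta> \<in> roots_of n A"

definition is_highest_root :: "nat \<Rightarrow> (nat \<Rightarrow> nat \<Rightarrow> int) \<Rightarrow> (nat \<Rightarrow> int) \<Rightarrow> bool" where
  "is_highest_root n A \<theta> \<longleftrightarrow> \<theta> \<in> roots_of n A \<and> (\<forall>\<beta>\<in>roots_of n A. \<forall>i\<in>{1..n}. \<beta> i \<le> \<theta> i)"

definition inv_form :: "nat \<Rightarrow> (nat \<Rightarrow> nat \<Rightarrow> int) \<Rightarrow> (nat \<Rightarrow> nat) \<Rightarrow> (nat \<Rightarrow> int) \<Rightarrow> (nat \<Rightarrow> int) \<Rightarrow> int" where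
  "inv_form n A d \<beta> \<gamma> = (\<Sum>i\<in>{1..n}. \<Sum>k\<in>{1..n}. \<beta> i * int (d i) * A i k * \<gamma> k)"

text \<open>Extended (untwisted affine) Cartan matrix on {0..n}: alpha_0 = delta - theta, so
  a_j0 = -<alpha_j^vee, theta>, a_0j = -<theta^vee, alpha_j> = -2(theta,alpha_j)/(theta,theta).\<close>
definition untwisted_affine_ext ::
  "nat \<Rightarrow> (nat \<Rightarrow> nat \<Rightarrow> int) \<Rightarrow> (nat \<Rightarrow> nat) \<Rightarrow> (nat \<Rightarrow> int) \<Rightarrow> (nat \<Rightarrow> nat \<Rightarrow> int) \<Rightarrow> bool" where
  "untwisted_affine_ext n A d \<theta> ahat \<longleftrightarrow>
     (\<forall>i\<in>{1..n}. \<forall>j\<in>{1..n}. ahat i j = A i j) \<and> ahat 0 0 = 2 \<and>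
     (\<forall>j\<in>{1..n}. ahat j 0 = - (\<Sum>i\<in>{1..n}. A j i * \<theta> i)) \<and>
     (\<forall>j\<in>{1..n}. inv_form n A d \<theta> \<theta> * ahat 0 j =
         - 2 * inv_form n A d \<theta> (\<lambda>k. if k = j then 1 else 0))"

text \<open>delta = sum a_i alpha_i with a_0 = 1 and a_i = theta_i for i in I.\<close>
definition kac_label :: "(nat \<Rightarrow> int) \<Rightarrow> nat \<Rightarrow> int" where
  "kac_label \<theta> i = (if i = 0 then 1 else \<theta> i)"

definition qint :: "'k::field \<Rightarrow> nat \<Rightarrow> 'k" where
  "qint v m = (v ^ m - inverse v ^ m) / (v - inverse v)"

definition qfact :: "'k::field \<Rightarrow> nat \<Rightarrow> 'k" where
  "qfact v m = (\<Prod>k\<in>{1..m}. qint v k)"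

definition qbinom :: "'k::field \<Rightarrow> nat \<Rightarrow> nat \<Rightarrow> 'k" where
  "qbinom v m r = qfact v m / (qfact v r * qfact v (m - r))"

definition msum :: "nat \<Rightarrow> ('x \<Rightarrow> 'a::semiring_1 mat) \<Rightarrow> 'x list \<Rightarrow> 'a mat" where
  "msum N f xs = foldr (\<lambda>x M. f x + M) xs (0\<^sub>m N N)"

definition mprod :: "nat \<Rightarrow> ('x \<Rightarrow> 'a::semiring_1 mat) \<Rightarrow> 'x list \<Rightarrow> 'a mat" where
  "mprod N f xs = foldr (\<lambda>x M. f x * M) xs (1\<^sub>m N)"

definition is_subspace :: "nat \<Rightarrow> 'a::field vec set \<Rightarrow> bool" where
  "is_subspace N W \<longleftrightarrow> W \<subseteq> carrier_vec N \<and> 0\<^sub>v N \<in> W \<and>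
     (\<forall>v\<in>W. \<forall>w\<in>W. v + w \<in> W) \<and> (\<forall>c. \<forall>v\<in>W. c \<cdot>\<^sub>v v \<in> W)"

inductive_set gen_alg :: "nat \<Rightarrow> 'a::field mat set \<Rightarrow> 'a mat set" for N G where
  one: "1\<^sub>m N \<in> gen_alg N G"
| gen: "g \<in> G \<Longrightarrow> g \<in> gen_alg N G"
| add: "M \<in> gen_alg N G \<Longrightarrow> M' \<in> gen_alg N G \<Longrightarrow> M + M' \<in> gen_alg N G"
| mult: "M \<in> gen_alg N G \<Longrightarrow> M' \<in> gen_alg N G \<Longrightarrow> M * M' \<in> gen_alg N G"
| smult: "M \<in> gen_alg N G \<Longrightarrow> c \<cdot>\<^sub>m M \<in> gen_alg N G"

definition irreducible_action :: "nat \<Rightarrow> 'a::field mat set \<Rightarrow> bool" where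
  "irreducible_action N G \<longleftrightarrow> N > 0 \<and>
     (\<forall>W. is_subspace N W \<and> (\<forall>M\<in>gen_alg N G. \<forall>w\<in>W. M *\<^sub>v w \<in> W) \<longrightarrow>
          W = {0\<^sub>v N} \<or> W = carrier_vec N)"

definition is_UqLg_rep ::
  "nat \<Rightarrow> (nat \<Rightarrow> nat \<Rightarrow> int) \<Rightarrow> (nat \<Rightarrow> nat) \<Rightarrow> (nat \<Rightarrow> int) \<Rightarrow> 'k::field \<Rightarrow> nat \<Rightarrow>
   (nat \<Rightarrow> 'k mat) \<Rightarrow> (nat \<Rightarrow> 'k mat) \<Rightarrow> (nat \<Rightarrow> 'k mat) \<Rightarrow> (nat \<Rightarrow> 'k mat) \<Rightarrow> bool" where
  "is_UqLg_rep n ahat d \<theta> q N Em Fm Km Kinv \<longleftrightarrow>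
     (\<forall>i\<in>{0..n}. Em i \<in> carrier_mat N N \<and> Fm i \<in> carrier_mat N N \<and>
                 Km i \<in> carrier_mat N N \<and> Kinv i \<in> carrier_mat N N) \<and>
     (\<forall>i\<in>{0..n}. Km i * Kinv i = 1\<^sub>m N \<and> Kinv i * Km i = 1\<^sub>m N) \<and>
     (\<forall>i\<in>{0..n}. \<forall>j\<in>{0..n}. Km i * Km j = Km j * Km i) \<and>
     (\<forall>i\<in>{0..n}. \<forall>j\<in>{0..n}.
        Km i * Em j * Kinv i = ((q ^ d i) powi (ahat i j)) \<cdot>\<^sub>m Em j \<and>
        Km i * Fm j * Kinv i = ((q ^ d i) powi (- ahat i j)) \<cdot>\<^sub>m Fm j) \<and>
     (\<forall>i\<in>{0..n}. \<forall>j\<in>{0..n}.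
        Em i * Fm j - Fm j * Em i =
          (if i = j then inverse (q ^ d i - inverse (q ^ d i)) \<cdot>\<^sub>m (Km i - Kinv i)
           else 0\<^sub>m N N)) \<and>
     (\<forall>i\<in>{0..n}. \<forall>j\<in>{0..n}. i \<noteq> j \<longrightarrow>
        (let m = nat (1 - ahat i j) in
          msum N (\<lambda>r. ((-1) ^ r * qbinom (q ^ d i) m r) \<cdot>\<^sub>m
                       (Em i ^\<^sub>m (m - r) * Em j * Em i ^\<^sub>m r)) [0..<Suc m] = 0\<^sub>m N N \<and>
          msum N (\<lambda>r. ((-1) ^ r * qbinom (q ^ d i) m r) \<cdot>\<^sub>m
                       (Fm i ^\<^sub>m (m - r) * Fm j * Fm i ^\<^sub>m r)) [0..<Suc m] = 0\<^sub>m N N)) \<and>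
     mprod N (\<lambda>i. Km i ^\<^sub>m nat (kac_label \<theta> i)) [0..<Suc n] = 1\<^sub>m N"

text \<open>Membership in Rep_fd: each K_i acts semisimply with eigenvalues in q^Z.\<close>
definition K_semisimple_qZ :: "nat \<Rightarrow> 'k::field \<Rightarrow> nat \<Rightarrow> (nat \<Rightarrow> 'k mat) \<Rightarrow> bool" where
  "K_semisimple_qZ n q N Km \<longleftrightarrow> (\<forall>i\<in>{0..n}. \<exists>P Pinv D.
      P \<in> carrier_mat N N \<and> Pinv \<in> carrier_mat N N \<and> D \<in> carrier_mat N N \<and>
      P * Pinv = 1\<^sub>m N \<and> Pinv * P = 1\<^sub>m N \<and>
      (\<forall>a<N. \<forall>b<N. a \<noteq> b \<longrightarrow> D $$ (a, b) = 0) \<and>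
      (\<forall>a<N. \<exists>m::int. D $$ (a, a) = q powi m) \<and>
      Km i = P * D * Pinv)"

definition UqLg_gens :: "nat \<Rightarrow> (nat \<Rightarrow> 'k mat) \<Rightarrow> (nat \<Rightarrow> 'k mat) \<Rightarrow> (nat \<Rightarrow> 'k mat) \<Rightarrow> (nat \<Rightarrow> 'k mat) \<Rightarrow> 'k mat set" where
  "UqLg_gens n Em Fm Km Kinv = (\<Union>i\<in>{0..n}. {Em i, Fm i, Km i, Kinv i})"

text \<open>Generators of \<open>\<hat>U\<^sup>\<ge>\<^sup>0\<close>: E_j, K_j, K_j^{-1}.  An element of \<open>\<hat>U\<^sup>\<ge>\<^sup>0\<close> is (the image of)
  a finite linear combination of words in these generators.\<close>
datatype geq0_gen = GE nat | GK nat | GKinv nat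

type_synonym 'k geq0_expr = "('k \<times> geq0_gen list) list"

fun gen_index :: "geq0_gen \<Rightarrow> nat" where
  "gen_index (GE j) = j" | "gen_index (GK j) = j" | "gen_index (GKinv j) = j"

fun E_degree :: "geq0_gen \<Rightarrow> nat" where
  "E_degree (GE j) = 1" | "E_degree (GK j) = 0" | "E_degree (GKinv j) = 0"

definition expr_in_Ihat :: "nat \<Rightarrow> 'k geq0_expr \<Rightarrow> bool" where
  "expr_in_Ihat n e \<longleftrightarrow> (\<forall>(c, w)\<in>set e. \<forall>g\<in>set w. gen_index g \<le> n)"

definition const_Fz :: "'k::field \<Rightarrow> 'k poly fract" where
  "const_Fz c = Fract [:c:] 1"

definition var_z :: "'k::field poly fract" where
  "var_z = Fract [:0, 1:] 1"

fun gen_mat :: "(nat \<Rightarrow> 'k mat) \<Rightarrow> (nat \<Rightarrow> 'k mat) \<Rightarrow> (nat \<Rightarrow> 'k mat) \<Rightarrow> geq0_gen \<Rightarrow> 'k mat" where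
  "gen_mat Em Km Kinv (GE j) = Em j"
| "gen_mat Em Km Kinv (GK j) = Km j"
| "gen_mat Em Km Kinv (GKinv j) = Kinv j"

text \<open>Action on V(z) of Sigma_z(x) for x the element given by the expression e:
  Sigma_z scales E_j by z and fixes K_j^{+-1}.\<close>
definition eval_shift :: "nat \<Rightarrow> (nat \<Rightarrow> 'k::field mat) \<Rightarrow> (nat \<Rightarrow> 'k mat) \<Rightarrow> (nat \<Rightarrow> 'k mat) \<Rightarrow>
    'k geq0_expr \<Rightarrow> 'k poly fract mat" where
  "eval_shift N Em Km Kinv e =
     msum N (\<lambda>(c, w). (const_Fz c * var_z ^ (\<Sum>g\<leftarrow>w. E_degree g)) \<cdot>\<^sub>m
                         mprod N (\<lambda>g. map_mat const_Fz (gen_mat Em Km Kinv g)) w) e"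

text \<open>Action on V(z) of Sigma_z(F_i + E_i') = z^{-1} F_i + Sigma_z(E_i').\<close>
definition modified_F_shift :: "nat \<Rightarrow> (nat \<Rightarrow> 'k::field mat) \<Rightarrow> (nat \<Rightarrow> 'k mat) \<Rightarrow> (nat \<Rightarrow> 'k mat) \<Rightarrow>
    (nat \<Rightarrow> 'k mat) \<Rightarrow> 'k geq0_expr \<Rightarrow> nat \<Rightarrow> 'k poly fract mat" where
  "modified_F_shift N Em Fm Km Kinv e i =
     inverse var_z \<cdot>\<^sub>m map_mat const_Fz (Fm i) + eval_shift N Em Km Kinv e"

end

theory Submission
  imports Defs "Jordan_Normal_Form.Determinant" "HOL-Library.Function_Algebras"
    "HOL-Computational_Algebra.Polynomial_Factorial"
begin

text \<open>Let \<open>W\<close> be an invariant subspace of \<open>V(z)\<close>. Since \<open>z \<Sigma>\<^sub>z(F\<^sub>i + E\<^sub>i') = F\<^sub>i + O(z)\<close>, the values at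
  \<open>z = 0\<close> of the polynomial vectors in \<open>W\<close> form a subspace of \<open>V\<close> that is stable under all \<open>F\<^sub>i\<close>,
  and it is zero or everything only if \<open>W\<close> is. Passing to the associated graded space for each
  \<open>K\<^sub>j\<close> in turn makes this subspace \<open>K\<close>-stable as well, again without leaving the class of
  nonzero proper subspaces. So it suffices to show that a subspace \<open>U\<close> stable under all \<open>F\<^sub>i\<close> and
  \<open>K\<^sub>i\<close> is stable under all \<open>E\<^sub>i\<close>.

  Let \<open>t\<^sub>i\<close> be the sum over a weight basis of \<open>U\<close> of the exponents of the eigenvalues of \<open>K\<^sub>i\<close>. The map
  \<open>F\<^sub>i\<^sup>k\<close> is injective from the eigenspace of \<open>K\<^sub>i\<close> for \<open>q\<^sub>i\<^sup>k\<close> to that for \<open>q\<^sub>i ^ (-k)\<close>, so \<open>t\<^sub>i \<le> 0\<close>,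
  and equality forces these maps to be bijections on \<open>U\<close>, which implies \<open>E\<^sub>i\<close>-stability. The
  relation \<open>\<Prod> K\<^sub>i ^ a\<^sub>i = 1\<close> gives \<open>\<Sum> a\<^sub>i t\<^sub>i = 0\<close> with all \<open>a\<^sub>i > 0\<close>, so every \<open>t\<^sub>i\<close> vanishes.\<close>

section \<open>Eigenspace decompositions and associated graded spaces\<close>

lemma power_int_inj_iff:
  fixes q :: "'k::field"
  assumes "q \<noteq> 0" and "\<And>m::int. q powi m = 1 \<Longrightarrow> m = 0"
  shows "q powi a = q powi b \<longleftrightarrow> a = b"
proof
  assume "q powi a = q powi b"
  then have "q powi (a - b) = 1"
    using assms(1) by (simp add: power_int_diff)
  then show "a = b"
    using assms(2) by fastforce
qed simp

text \<open>\<open>K\<close> is diagonalisable on \<open>V\<close> with eigenvalues in q^Z,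
  \<open>Pr m\<close> is the projection onto the eigenspace for \<open>q powi m\<close>, and
  \<open>M\<close> is a finite set containing every exponent that occurs. The data are parameters so
  that one space \<open>V\<close> can carry an instance for each K_i.\<close>

locale eigenspace_decomposition = vector_space scale
  for scale :: "'k::field \<Rightarrow> 'b::ab_group_add \<Rightarrow> 'b" (infixr "*s" 75) +
  fixes V :: "'b set" and q :: 'k and K :: "'b \<Rightarrow> 'b"
    and Pr :: "int \<Rightarrow> 'b \<Rightarrow> 'b" and M :: "int set"
  assumes V_subspace: "subspace V"
    and q_nonzero: "q \<noteq> 0"
    and q_not_root: "\<And>m::int. q powi m = 1 \<Longrightarrow> m = 0"
    and K_linear: "Vector_Spaces.linear scale scale K"
    and Pr_linear: "\<And>m. Vector_Spaces.linear scale scale (Pr m)"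
    and finite_M: "finite M"
    and Pr_V: "\<And>m v. v \<in> V \<Longrightarrow> Pr m v \<in> V"
    and K_Pr: "\<And>m v. v \<in> V \<Longrightarrow> K (Pr m v) = q powi m *s Pr m v"
    and Pr_eigen: "\<And>m l v. v \<in> V \<Longrightarrow> K v = q powi m *s v \<Longrightarrow> Pr l v = (if l = m then v else 0)"
    and sum_Pr: "\<And>v. v \<in> V \<Longrightarrow> (\<Sum>m\<in>M. Pr m v) = v"
begin

sublocale endo: vector_space_pair scale scale ..

section \<open>Eigenspaces of \<open>K\<close> and their projections\<close>

definition wt :: "int \<Rightarrow> 'b set" where
  "wt m = {v \<in> V. K v = q powi m *s v}"

lemma subspace_scale_cancel:
  assumes "subspace W" "c *s v \<in> W" "c \<noteq> 0"
  shows "v \<in> W"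
  using subspace_scale[OF assms(1,2), of "inverse c"] assms(3) by simp

lemma q_powi_inj: "q powi a = q powi b \<longleftrightarrow> a = b"
  by (rule power_int_inj_iff[OF q_nonzero q_not_root])

lemma wt_subspace: "subspace (wt m)"
  using V_subspace unfolding wt_def subspace_def
  by (auto simp: endo.linear_0[OF K_linear] endo.linear_add[OF K_linear] endo.linear_scale[OF K_linear]
      scale_right_distrib mult.commute)

lemma Pr_wt: "v \<in> V \<Longrightarrow> Pr m v \<in> wt m"
  by (simp add: wt_def Pr_V K_Pr)

lemma Pr_Pr: "v \<in> V \<Longrightarrow> Pr l (Pr m v) = (if l = m then Pr m v else 0)"
  by (rule Pr_eigen) (simp_all add: Pr_V K_Pr)

lemma Pr_not_M:
  assumes "v \<in> V" "m \<notin> M"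
  shows "Pr m v = 0"
proof -
  have "Pr m v = Pr m (\<Sum>l\<in>M. Pr l v)"
    using assms by (simp add: sum_Pr)
  also have "\<dots> = (\<Sum>l\<in>M. Pr m (Pr l v))"
    by (rule endo.linear_sum[OF Pr_linear])
  also have "\<dots> = 0"
    using assms by (intro sum.neutral) (auto simp: Pr_Pr)
  finally show ?thesis .
qed

lemma wt_not_M: "m \<notin> M \<Longrightarrow> v \<in> wt m \<Longrightarrow> v = 0"
  using Pr_not_M[of v m] Pr_eigen[of v m m] by (auto simp: wt_def)

text \<open>Applying \<open>K - q powi t\<close> to the sum removes the component at
  \<open>t\<close> and multiplies the component at each other exponent \<open>r\<close> by the
  nonzero scalar \<open>q powi r - q powi t\<close>. Induction on the number of components then
  separates them inside \<open>W\<close>.\<close>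

lemma eigen_component:
  assumes W: "subspace W" and KW: "\<And>w. w \<in> W \<Longrightarrow> K w \<in> W"
    and "finite S" "\<And>s. s \<in> S \<Longrightarrow> u s \<in> wt s" "(\<Sum>s\<in>S. u s) \<in> W" "s \<in> S"
  shows "u s \<in> W"
  using assms(3-)
proof (induction S arbitrary: u s rule: finite_induct)
  case (insert t S)
  have rest: "u s' \<in> W" if s': "s' \<in> S" for s'
  proof -
    let ?u = "\<lambda>r. (q powi r - q powi t) *s u r"
    have "K (\<Sum>r\<in>insert t S. u r) - q powi t *s (\<Sum>r\<in>insert t S. u r)
        = (\<Sum>r\<in>insert t S. K (u r) - q powi t *s u r)"
      by (simp only: endo.linear_sum[OF K_linear] scale_sum_right sum_subtractf)
    also have "\<dots> = (\<Sum>r\<in>insert t S. ?u r)"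
      using insert.prems(1) by (intro sum.cong refl) (auto simp: wt_def scale_left_diff_distrib)
    also have "\<dots> = (\<Sum>r\<in>S. ?u r)"
      using insert.hyps by simp
    finally have "(\<Sum>r\<in>S. ?u r) \<in> W"
      using KW[OF insert.prems(2)] insert.prems(2) W by (metis subspace_diff subspace_scale)
    moreover have "?u r \<in> wt r" if "r \<in> S" for r
      using that insert.prems(1) wt_subspace by (auto intro: subspace_scale)
    ultimately have "?u s' \<in> W"
      using insert.IH[of ?u s'] s' by blast
    moreover have "q powi s' - q powi t \<noteq> 0"
      using insert.hyps s' by (auto simp: q_powi_inj)
    ultimately show ?thesis
      by (rule subspace_scale_cancel[OF W])
  qed
  have "u t = (\<Sum>r\<in>insert t S. u r) - (\<Sum>r\<in>S. u r)"
    using insert.hyps by simp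
  moreover have "(\<Sum>r\<in>S. u r) \<in> W"
    using rest by (intro subspace_sum[OF W]) auto
  ultimately have "u t \<in> W"
    using subspace_diff[OF W insert.prems(2)] by metis
  then show ?case
    using rest insert.prems(3) by blast
qed simp

text \<open>Hence a \<open>K\<close>-stable subspace is graded: it contains the eigencomponents of
  each of its elements.\<close>

lemma Pr_mem:
  assumes W: "subspace W" and KW: "\<And>w. w \<in> W \<Longrightarrow> K w \<in> W" and w: "w \<in> W" "w \<in> V"
  shows "Pr m w \<in> W"
proof (cases "m \<in> M")
  case True
  show ?thesis
    by (rule eigen_component[OF W KW finite_M, of "\<lambda>m. Pr m w"])
      (use True w in \<open>auto simp: Pr_wt sum_Pr\<close>)
next
  case False
  then show ?thesis
    using Pr_not_M w W by (simp add: subspace_0)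
qed

text \<open>Since \<open>T\<close> lowers exponents by \<open>c\<close>, only the component of
  \<open>v\<close> at \<open>m + c\<close> can contribute to the component of \<open>T v\<close> at
  \<open>m\<close>.\<close>

lemma Pr_shift:
  assumes T: "Vector_Spaces.linear scale scale T" and TV: "\<And>v. v \<in> V \<Longrightarrow> T v \<in> V"
    and shift: "\<And>m v. v \<in> wt m \<Longrightarrow> T v \<in> wt (m - c)" and v: "v \<in> V"
  shows "Pr m (T v) = T (Pr (m + c) v)"
proof -
  have "Pr m (T v) = Pr m (T (\<Sum>l\<in>M. Pr l v))"
    using v by (simp add: sum_Pr)
  also have "\<dots> = (\<Sum>l\<in>M. Pr m (T (Pr l v)))"
    by (simp add: endo.linear_sum[OF Pr_linear] endo.linear_sum[OF T])
  also have "\<dots> = (\<Sum>l\<in>M. if l = m + c then T (Pr (m + c) v) else 0)"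
  proof (rule sum.cong)
    fix l assume "l \<in> M"
    have "T (Pr l v) \<in> wt (l - c)"
      using shift Pr_wt v by blast
    then have "Pr m (T (Pr l v)) = (if m = l - c then T (Pr l v) else 0)"
      using Pr_eigen by (simp add: wt_def)
    then show "Pr m (T (Pr l v)) = (if l = m + c then T (Pr (m + c) v) else 0)"
      by (auto simp: algebra_simps)
  qed simp
  \<comment> \<open>If \<open>m + c\<close> lies outside \<open>M\<close>, no summand survives, and
    \<open>Pr (m + c) v\<close> is zero as well.\<close>
  also have "\<dots> = T (Pr (m + c) v)"
    using finite_M Pr_not_M[OF v, of "m + c"] by (auto simp: endo.linear_0[OF T])
  finally show ?thesis .
qed

text \<open>The associated graded space of \<open>W\<close>: the span of the lowest-degree components of its elements.\<close>
definition gr :: "'b set \<Rightarrow> 'b set" where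
  "gr W = {v \<in> V. \<forall>m. \<exists>w\<in>W. (\<forall>l<m. Pr l w = 0) \<and> Pr m w = Pr m v}"

lemma gr_V: "gr W \<subseteq> V"
  by (auto simp: gr_def)

lemma gr_subspace:
  assumes W: "subspace W"
  shows "subspace (gr W)"
  unfolding subspace_def
proof (intro conjI ballI allI)
  show "0 \<in> gr W"
    using W V_subspace by (auto simp: gr_def subspace_0 endo.linear_0[OF Pr_linear] intro!: bexI[of _ 0])
next
  fix x y assume x: "x \<in> gr W" and y: "y \<in> gr W"
  have "\<exists>w\<in>W. (\<forall>l<m. Pr l w = 0) \<and> Pr m w = Pr m (x + y)" for m
  proof -
    obtain a where "a \<in> W" "\<forall>l<m. Pr l a = 0" "Pr m a = Pr m x" using x by (auto simp: gr_def)
    moreover obtain b where "b \<in> W" "\<forall>l<m. Pr l b = 0" "Pr m b = Pr m y" using y by (auto simp: gr_def)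
    ultimately show ?thesis
      using W by (intro bexI[of _ "a + b"]) (auto simp: endo.linear_add[OF Pr_linear] subspace_add)
  qed
  then show "x + y \<in> gr W"
    using x y V_subspace by (auto simp: gr_def subspace_add)
next
  fix c x assume x: "x \<in> gr W"
  have "\<exists>w\<in>W. (\<forall>l<m. Pr l w = 0) \<and> Pr m w = Pr m (c *s x)" for m
  proof -
    obtain a where "a \<in> W" "\<forall>l<m. Pr l a = 0" "Pr m a = Pr m x" using x by (auto simp: gr_def)
    then show ?thesis
      using W by (intro bexI[of _ "c *s a"]) (auto simp: endo.linear_scale[OF Pr_linear] subspace_scale)
  qed
  then show "c *s x \<in> gr W"
    using x V_subspace by (auto simp: gr_def subspace_scale)
qed

text \<open>If \<open>w\<close> is a witness in \<open>W\<close> for the component of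
  \<open>v\<close> at \<open>m + c\<close>, then \<open>T w\<close> is a witness for the component
  of \<open>T v\<close> at \<open>m\<close>. Later \<open>T\<close> is some F_i, or a K_i commuting
  with \<open>K\<close>, in which case \<open>c = 0\<close>.\<close>

lemma gr_shift:
  assumes T: "Vector_Spaces.linear scale scale T" and TV: "\<And>v. v \<in> V \<Longrightarrow> T v \<in> V"
    and shift: "\<And>m v. v \<in> wt m \<Longrightarrow> T v \<in> wt (m - c)" and WV: "W \<subseteq> V"
    and TW: "\<And>w. w \<in> W \<Longrightarrow> T w \<in> W" and v: "v \<in> gr W"
  shows "T v \<in> gr W"
proof -
  have vV: "v \<in> V" using v gr_V by blast
  have "\<exists>w\<in>W. (\<forall>l<m. Pr l w = 0) \<and> Pr m w = Pr m (T v)" for m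
  proof -
    obtain w where w: "w \<in> W" "\<forall>l<m + c. Pr l w = 0" "Pr (m + c) w = Pr (m + c) v"
      using v by (auto simp: gr_def)
    then have "w \<in> V" using WV by blast
    then have "Pr l (T w) = T (Pr (l + c) w)" for l
      using Pr_shift[OF T TV shift] by blast
    then show ?thesis
      using w TW Pr_shift[OF T TV shift vV] by (intro bexI[of _ "T w"]) (auto simp: endo.linear_0[OF T])
  qed
  then show ?thesis
    using TV vV by (auto simp: gr_def)
qed

text \<open>The passage to \<open>gr W\<close> creates \<open>K\<close>-stability: in degree
  \<open>m\<close> the map \<open>K\<close> is multiplication by \<open>q powi m\<close>, so a
  witness for \<open>v\<close> only has to be rescaled.\<close>

lemma gr_K:
  assumes W: "subspace W" and v: "v \<in> gr W"
  shows "K v \<in> gr W"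
proof -
  have vV: "v \<in> V" using v gr_V by blast
  \<comment> \<open>That \<open>K\<close> maps \<open>V\<close> to itself is read off from its
    action on eigencomponents.\<close>
  have KV: "K u \<in> V" if "u \<in> wt m" for u m
    using that V_subspace by (auto simp: wt_def intro: subspace_scale)
  have Kv: "K v = (\<Sum>m\<in>M. K (Pr m v))"
    using sum_Pr[OF vV] endo.linear_sum[OF K_linear] by metis
  then have KvV: "K v \<in> V"
    using V_subspace KV Pr_wt[OF vV] by (auto intro: subspace_sum)
  have PrK: "Pr m (K v) = q powi m *s Pr m v" for m
  proof -
    have "Pr m (K v) = (\<Sum>l\<in>M. q powi l *s Pr m (Pr l v))"
      by (simp add: Kv endo.linear_sum[OF Pr_linear] endo.linear_scale[OF Pr_linear] K_Pr vV)
    also have "\<dots> = (\<Sum>l\<in>M. q powi m *s Pr m (Pr l v))"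
      by (intro sum.cong refl) (auto simp: Pr_Pr vV)
    also have "\<dots> = q powi m *s Pr m v"
      using sum_Pr[OF vV] endo.linear_sum[OF Pr_linear] scale_sum_right by metis
    finally show ?thesis .
  qed
  have "\<exists>w\<in>W. (\<forall>l<m. Pr l w = 0) \<and> Pr m w = Pr m (K v)" for m
  proof -
    obtain w where "w \<in> W" "\<forall>l<m. Pr l w = 0" "Pr m w = Pr m v"
      using v by (auto simp: gr_def)
    then show ?thesis
      using W by (intro bexI[of _ "q powi m *s w"])
        (auto simp: endo.linear_scale[OF Pr_linear] PrK intro: subspace_scale)
  qed
  then show ?thesis using KvV by (auto simp: gr_def)
qed

text \<open>On each eigencomponent a left inverse of \<open>K\<close> is multiplication by the
  inverse eigenvalue, and these components lie in \<open>W\<close> by \<open>Pr_mem\<close>. This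
  serves the generators K_i^(-1).\<close>

lemma inverse_stable:
  assumes T: "Vector_Spaces.linear scale scale T" and TK: "\<And>v. v \<in> V \<Longrightarrow> T (K v) = v"
    and W: "subspace W" "W \<subseteq> V" and KW: "\<And>w. w \<in> W \<Longrightarrow> K w \<in> W" and w: "w \<in> W"
  shows "T w \<in> W"
proof -
  have wV: "w \<in> V" using w W by blast
  have "T (Pr m w) \<in> W" for m
  proof -
    have "q powi m *s T (Pr m w) = Pr m w"
      using TK[OF Pr_V[OF wV, of m]] by (simp add: K_Pr wV endo.linear_scale[OF T])
    then show ?thesis
      using Pr_mem[OF W(1) KW w wV] q_nonzero subspace_scale_cancel[OF W(1), of "q powi m"] by simp
  qed
  then have "(\<Sum>m\<in>M. T (Pr m w)) \<in> W"
    using W by (intro subspace_sum) auto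
  then show ?thesis
    using sum_Pr[OF wV] by (simp add: endo.linear_sum[OF T, symmetric])
qed

text \<open>Successive approximation: subtracting from \<open>v\<close> an element of
  \<open>W\<close> with the same lowest component leaves a remainder that starts in higher degree.
  As \<open>M\<close> is finite, the remainder is eventually zero.\<close>

lemma gr_eq_V:
  assumes W: "subspace W" "W \<subseteq> V" and gr: "gr W = V"
  shows "W = V"
proof -
  \<comment> \<open>\<open>b\<close> exceeds every exponent in \<open>M\<close>. The induction is on
    the distance \<open>k\<close> from \<open>b\<close> down to the degree below which all
    components of \<open>v\<close> vanish.\<close>
  define b where "b = (if M = {} then 0 else Max M + 1)"
  have bM: "l < b" if "l \<in> M" for l
    using that finite_M Max_ge[OF finite_M that] by (auto simp: b_def intro: le_less_trans)
  have "v \<in> W" if "v \<in> V" "\<forall>l < b - int k. Pr l v = 0" for k v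
    using that
  proof (induction k arbitrary: v)
    case 0
    then have "(\<Sum>m\<in>M. Pr m v) = 0"
      using bM by (intro sum.neutral) auto
    then show ?case
      using sum_Pr 0 W by (simp add: subspace_0)
  next
    case (Suc k)
    let ?m = "b - int (Suc k)"
    obtain w where w: "w \<in> W" "\<forall>l<?m. Pr l w = 0" "Pr ?m w = Pr ?m v"
      using Suc.prems(1) gr by (force simp: gr_def)
    have "v - w \<in> W"
    proof (rule Suc.IH)
      show "v - w \<in> V"
        using V_subspace W w Suc.prems by (auto intro: subspace_diff)
      show "\<forall>l<b - int k. Pr l (v - w) = 0"
      proof (intro allI impI)
        fix l assume "l < b - int k"
        then consider "l < ?m" | "l = ?m" by fastforce
        then show "Pr l (v - w) = 0"
          by cases (use w Suc.prems in \<open>auto simp: endo.linear_diff[OF Pr_linear]\<close>)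
      qed
    qed
    then show ?case
      using w W by (metis diff_add_cancel subspace_add)
  qed
  moreover have "\<exists>k. \<forall>l < b - int k. Pr l v = 0" if v: "v \<in> V" for v
  proof (intro exI allI impI)
    \<comment> \<open>The witness \<open>k\<close> is the distance from \<open>b\<close> down to
      \<open>Min M\<close>, so all degrees below \<open>b - int k\<close> lie outside
      \<open>M\<close>.\<close>
    fix l assume l: "l < b - int (nat (b - (if M = {} then 0 else Min M)))"
    have "l \<notin> M"
      using l Min_le[OF finite_M, of l] by (auto split: if_splits)
    then show "Pr l v = 0" using Pr_not_M v by blast
  qed
  ultimately show ?thesis using W by blast
qed

text \<open>The lowest nonzero component of a nonzero \<open>w\<close> in \<open>W\<close> would be
  a nonzero element of \<open>gr W\<close>.\<close>

lemma gr_eq_0: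
  assumes W: "subspace W" "W \<subseteq> V" and gr: "gr W = {0}"
  shows "W = {0}"
proof -
  have "w = 0" if w: "w \<in> W" for w
  proof (rule ccontr)
    assume "w \<noteq> 0"
    have wV: "w \<in> V" using w W by blast
    define S where "S = {m \<in> M. Pr m w \<noteq> 0}"
    have "finite S" using finite_M by (simp add: S_def)
    have "S \<noteq> {}"
    proof
      assume "S = {}"
      then have "(\<Sum>m\<in>M. Pr m w) = 0" by (intro sum.neutral) (auto simp: S_def)
      then show False using sum_Pr wV \<open>w \<noteq> 0\<close> by simp
    qed
    define m where "m = Min S"
    have m: "Pr m w \<noteq> 0"
      using Min_in[OF \<open>finite S\<close> \<open>S \<noteq> {}\<close>] by (simp add: m_def S_def)
    have low: "Pr l w = 0" if "l < m" for l
    proof (rule ccontr)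
      assume *: "Pr l w \<noteq> 0"
      then have "l \<in> S" using Pr_not_M[OF wV, of l] by (auto simp: S_def)
      then show False using Min_le[OF \<open>finite S\<close>, of l] that by (simp add: m_def)
    qed
    have "Pr m w \<in> gr W"
      unfolding gr_def
    proof (intro CollectI conjI allI)
      fix l
      show "\<exists>w'\<in>W. (\<forall>l'<l. Pr l' w' = 0) \<and> Pr l w' = Pr l (Pr m w)"
      proof (cases "l = m")
        case True
        then show ?thesis using w low Pr_Pr[OF wV] by auto
      next
        case False
        then show ?thesis
          using W Pr_Pr[OF wV] by (intro bexI[of _ 0]) (auto simp: endo.linear_0[OF Pr_linear] subspace_0)
      qed
    qed (use Pr_V wV in auto)
    then show False using gr m by blast
  qed
  then show ?thesis using subspace_0[OF W(1)] by blast
qed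

end

section \<open>Subspaces of quantum \<open>sl\<^sub>2\<close> representations stable under \<open>F\<close>\<close>

text \<open>Quantum sl_2 at the parameter q^d, with \<open>\<kappa>\<close> in the place of 1 / (q^d
  - q^(-d)). The relations are imposed on eigenvectors of \<open>K\<close>, where K - K^(-1) is the
  scalar \<open>q powi m - q powi (- m)\<close>.\<close>

locale quantum_sl2 = eigenspace_decomposition +
  fixes E F :: "'b \<Rightarrow> 'b" and d :: int and \<kappa> :: 'a
  assumes d_pos: "d > 0" and \<kappa>_nonzero: "\<kappa> \<noteq> 0"
    and E_linear: "Vector_Spaces.linear scale scale E"
    and F_linear: "Vector_Spaces.linear scale scale F"
    and E_wt: "\<And>m v. v \<in> wt m \<Longrightarrow> E v \<in> wt (m + 2 * d)"
    and F_wt: "\<And>m v. v \<in> wt m \<Longrightarrow> F v \<in> wt (m - 2 * d)"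
    and E_F: "\<And>m v. v \<in> wt m \<Longrightarrow> E (F v) = F (E v) + (\<kappa> * (q powi m - q powi (- m))) *s v"
begin

section \<open>Commutation of \<open>E\<close> with powers of \<open>F\<close>\<close>

lemma Fpow_linear: "Vector_Spaces.linear scale scale (F ^^ k)"
proof (induction k)
  case 0
  show ?case by unfold_locales auto
next
  case (Suc k)
  then show ?case
    using Vector_Spaces.linear_compose[OF _ F_linear] by (simp add: o_def)
qed

lemma Fpow_wt: "v \<in> wt m \<Longrightarrow> (F ^^ k) v \<in> wt (m - 2 * d * int k)"
proof (induction k)
  case (Suc k)
  then show ?case using F_wt by (fastforce simp: algebra_simps)
qed simp

lemma Epow_wt: "v \<in> wt m \<Longrightarrow> (E ^^ k) v \<in> wt (m + 2 * d * int k)"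
proof (induction k)
  case (Suc k)
  then show ?case using E_wt by (fastforce simp: algebra_simps)
qed simp

text \<open>The coefficient of F^(k-1) in the commutator of \<open>E\<close> with F^k on exponent
  \<open>m\<close>. With Q = q^d, m = d h and \<kappa> = 1 / (Q - Q^(-1)), it is the product of
  quantum integers [k]_Q [h - k + 1]_Q.\<close>

definition coef :: "nat \<Rightarrow> int \<Rightarrow> 'a" where
  "coef k m = \<kappa> / (q powi d - q powi (- d)) * (q powi (d * int k) - q powi (- (d * int k))) *
     (q powi (m - d * (int k - 1)) - q powi (- (m - d * (int k - 1))))"

text \<open>The added scalar is the value of \<kappa> (K - K^(-1)) on \<open>(F ^^ k) v\<close>,
  whose exponent is \<open>m - 2 * d * int k\<close>. In the monomials \<open>X\<close>,
  \<open>Y\<close>, \<open>Q\<close> the claim is a Laurent polynomial identity, multiplied by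
  \<open>\<kappa> / (Q - inverse Q)\<close>.\<close>

lemma coef_Suc: "coef (Suc k) m = coef k m + \<kappa> * (q powi (m - 2 * d * int k) - q powi (- (m - 2 * d * int k)))"
proof -
  define X Y Q where "X = q powi m" and "Y = q powi (d * int k)" and "Q = q powi d"
  have nz: "X \<noteq> 0" "Y \<noteq> 0" "Q \<noteq> 0" "Q - inverse Q \<noteq> 0"
    using q_nonzero d_pos q_powi_inj[of d "- d"] by (auto simp: X_def Y_def Q_def power_int_minus)
  have exps: "d * int (Suc k) = d * int k + d" "m - d * (int (Suc k) - 1) = m - d * int k"
    "m - d * (int k - 1) = m - d * int k + d" "m - 2 * d * int k = m - d * int k - d * int k"
    by (simp_all add: algebra_simps)
  have "(Y * Q - inverse (Y * Q)) * (X / Y - inverse (X / Y)) =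
     (Y - inverse Y) * (X / Y * Q - inverse (X / Y * Q)) +
     (Q - inverse Q) * (X / Y / Y - inverse (X / Y / Y))"
    using nz(1-3) by (simp add: field_simps)
  then have "\<kappa> / (Q - inverse Q) * ((Y * Q - inverse (Y * Q)) * (X / Y - inverse (X / Y))) =
     \<kappa> / (Q - inverse Q) * ((Y - inverse Y) * (X / Y * Q - inverse (X / Y * Q))) +
     \<kappa> / (Q - inverse Q) * (Q - inverse Q) * (X / Y / Y - inverse (X / Y / Y))"
    by (simp only: distrib_left mult.assoc)
  then have "\<kappa> / (Q - inverse Q) * (Y * Q - inverse (Y * Q)) * (X / Y - inverse (X / Y)) =
     \<kappa> / (Q - inverse Q) * (Y - inverse Y) * (X / Y * Q - inverse (X / Y * Q)) +
     \<kappa> * (X / Y / Y - inverse (X / Y / Y))"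
    using nz(4) by (simp only: mult.assoc nonzero_eq_divide_eq times_divide_eq_left)
       (simp add: mult.assoc)
  then show ?thesis
    unfolding coef_def exps power_int_minus power_int_add[OF disjI1[OF q_nonzero]]
      power_int_diff[OF disjI1[OF q_nonzero]] X_def[symmetric] Y_def[symmetric] Q_def[symmetric] .
qed

text \<open>Every difference in \<open>coef\<close> has the form
  \<open>q powi a - q powi (- a)\<close> with \<open>a\<close> nonzero, and \<open>q\<close> is not
  a root of unity.\<close>

lemma coef_nonzero:
  assumes "k > 0" "m \<noteq> d * (int k - 1)"
  shows "coef k m \<noteq> 0"
proof -
  have "d \<noteq> - d" "d * int k \<noteq> - (d * int k)"
      "m - d * (int k - 1) \<noteq> - (m - d * (int k - 1))"
    using assms d_pos by auto
  then have "q powi d - q powi (- d) \<noteq> 0" "q powi (d * int k) - q powi (- (d * int k)) \<noteq> 0"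
      "q powi (m - d * (int k - 1)) - q powi (- (m - d * (int k - 1))) \<noteq> 0"
    unfolding right_minus_eq q_powi_inj by simp_all
  then show ?thesis
    unfolding coef_def using \<kappa>_nonzero by (metis divide_eq_0_iff no_zero_divisors)
qed

text \<open>\<open>E\<close> is moved past one factor \<open>F\<close> at a time;
  \<open>coef_Suc\<close> adds up the resulting scalars.\<close>

lemma E_Fpow:
  assumes v: "v \<in> wt m"
  shows "E ((F ^^ k) v) = (F ^^ k) (E v) + coef k m *s (F ^^ (k - 1)) v"
proof (induction k)
  case 0
  show ?case by (simp add: coef_def)
next
  case (Suc k)
  \<comment> \<open>At \<open>k = 0\<close> truncated subtraction makes \<open>F ^^ (k - 1)\<close>
    the identity, but the coefficient is then zero.\<close>
  have 1: "F ((F ^^ (k - 1)) v) = (F ^^ k) v \<or> coef k m = 0"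
    by (cases k) (auto simp: coef_def)
  have "E ((F ^^ Suc k) v) = F (E ((F ^^ k) v)) +
      (\<kappa> * (q powi (m - 2 * d * int k) - q powi (- (m - 2 * d * int k)))) *s (F ^^ k) v"
    using E_F[OF Fpow_wt[OF v]] by simp
  also have "F (E ((F ^^ k) v)) = (F ^^ Suc k) (E v) + coef k m *s (F ^^ k) v"
    using 1 by (auto simp: Suc.IH endo.linear_add[OF F_linear] endo.linear_scale[OF F_linear])
  finally show ?case
    by (simp add: coef_Suc scale_left_distrib add.assoc)
qed

section \<open>Highest weight vectors and injectivity of powers of \<open>F\<close>\<close>

lemma eventually_not_M: "\<exists>B. \<forall>k::nat. k > B \<longrightarrow> m + d * int k \<notin> M \<and> m - d * int k \<notin> M"
proof -
  obtain b where b: "\<And>l. l \<in> M \<Longrightarrow> \<bar>l\<bar> \<le> b"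
    using bdd_above_finite[of "abs ` M"] finite_M by (auto simp: bdd_above_def)
  have "m + d * int k \<notin> M \<and> m - d * int k \<notin> M" if "k > nat (b + \<bar>m\<bar>)" for k
  proof -
    have "int k > b + \<bar>m\<bar>" using that by linarith
    moreover have "d * int k \<ge> int k" using d_pos by (simp add: mult_le_cancel_right1)
    ultimately have "\<bar>m + d * int k\<bar> > b" "\<bar>m - d * int k\<bar> > b" by linarith+
    then show ?thesis using b by force
  qed
  then show ?thesis by blast
qed

text \<open>Powers of \<open>E\<close> move the exponent out of the finite set \<open>M\<close>, so
  some power kills \<open>v\<close>; the last nonzero one is a highest weight vector.\<close>

lemma highest_weight_vector:
  assumes v: "v \<in> wt m" "v \<noteq> 0"
  obtains j where "(E ^^ j) v \<noteq> 0" "E ((E ^^ j) v) = 0"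
proof -
  obtain B where B: "\<forall>k::nat. k > B \<longrightarrow> m + d * int k \<notin> M"
    using eventually_not_M by blast
  have "m + 2 * d * int (Suc B) \<notin> M"
    using B[rule_format, of "2 * Suc B"] by (simp add: algebra_simps)
  then have "(E ^^ Suc B) v = 0"
    using Epow_wt[OF v(1)] wt_not_M by blast
  then obtain j where "(E ^^ j) v = 0" "\<And>i. i < j \<Longrightarrow> (E ^^ i) v \<noteq> 0"
    using exists_least_iff[of "\<lambda>j. (E ^^ j) v = 0"] by blast
  then show ?thesis
    using that[of "j - 1"] v by (cases j) auto
qed

text \<open>Applying \<open>E\<close> to F^(s+1) x = 0 leaves \<open>coef (Suc s) m\<close> times
  F^s x. This coefficient vanishes only at m = d s, which is below the assumed bound, so the power
  of \<open>F\<close> can be lowered down to zero.\<close>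

lemma highest_weight_Fpow:
  assumes "x \<in> wt m" "E x = 0"
  shows "(F ^^ s) x = 0 \<Longrightarrow> m \<ge> d * int s \<Longrightarrow> x = 0"
proof (induction s)
  case (Suc s)
  have "coef (Suc s) m *s (F ^^ s) x = 0"
    using E_Fpow[OF assms(1), of "Suc s"] Suc.prems(1) assms(2)
    by (simp add: endo.linear_0[OF E_linear] endo.linear_0[OF Fpow_linear] endo.linear_0[OF F_linear])
  moreover have "coef (Suc s) m \<noteq> 0"
    using Suc.prems(2) d_pos by (intro coef_nonzero) (auto simp: algebra_simps)
  ultimately have "(F ^^ s) x = 0" by simp
  then show ?case
    using Suc d_pos by (simp add: algebra_simps)
qed simp

text \<open>Eigenvalues are only known to be powers of \<open>q\<close>, and here they are shown to
  be powers of q^d. For a highest weight vector \<open>x\<close> above \<open>v\<close>, the first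
  \<open>s\<close> with F^s x = 0 forces \<open>coef s m' = 0\<close>, so m' = d (s - 1); going down
  to \<open>v\<close> changes this by an even multiple of \<open>d\<close>.\<close>

lemma weight_multiple:
  assumes v: "v \<in> wt m" "v \<noteq> 0"
  shows "d dvd m"
proof -
  obtain j where j: "(E ^^ j) v \<noteq> 0" "E ((E ^^ j) v) = 0"
    using highest_weight_vector[OF v] .
  define x m' where "x = (E ^^ j) v" and "m' = m + 2 * d * int j"
  have x: "x \<in> wt m'" "x \<noteq> 0" "E x = 0"
    using j Epow_wt[OF v(1)] by (auto simp: x_def m'_def)
  obtain B where B: "\<forall>k::nat. k > B \<longrightarrow> m' - d * int k \<notin> M"
    using eventually_not_M by blast
  have "m' - 2 * d * int (Suc B) \<notin> M"
    using B[rule_format, of "2 * Suc B"] by (simp add: algebra_simps)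
  then have "(F ^^ Suc B) x = 0"
    using Fpow_wt[OF x(1)] wt_not_M by blast
  then obtain s where s: "(F ^^ s) x = 0" "\<And>i. i < s \<Longrightarrow> (F ^^ i) x \<noteq> 0"
    using exists_least_iff[of "\<lambda>s. (F ^^ s) x = 0"] by blast
  have "s > 0" using s(1) x(2) by (cases s) auto
  have "coef s m' *s (F ^^ (s - 1)) x = 0"
    using E_Fpow[OF x(1), of s] s(1) x(3)
    by (simp add: endo.linear_0[OF E_linear] endo.linear_0[OF Fpow_linear])
  then have "coef s m' = 0"
    using s(2)[of "s - 1"] \<open>s > 0\<close> by simp
  then have "m' = d * (int s - 1)"
    using coef_nonzero \<open>s > 0\<close> by blast
  then have "m = d * (int s - 1 - 2 * int j)"
    by (simp add: m'_def algebra_simps)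
  then show ?thesis by simp
qed

text \<open>Injectivity of F^k on exponents at least d k. The vanishing is carried from
  \<open>v\<close> up to a highest weight vector E^j v, where \<open>highest_weight_Fpow\<close>
  contradicts it.\<close>

lemma Fpow_eq_0:
  assumes v: "v \<in> wt m" "(F ^^ k) v = 0" and m: "m \<ge> d * int k"
  shows "v = 0"
proof (rule ccontr)
  assume "v \<noteq> 0"
  then obtain j where j: "(E ^^ j) v \<noteq> 0" "E ((E ^^ j) v) = 0"
    using highest_weight_vector[OF v(1)] by blast
  \<comment> \<open>Applying \<open>E\<close> to F^(k+i+1) E^i v = 0 and using the induction
    hypothesis for the coefficient term leaves F^(k+i+1) E^(i+1) v = 0.\<close>
  have F0: "(F ^^ (k + i)) ((E ^^ i) v) = 0" for i
  proof (induction i)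
    case (Suc i)
    have "E ((F ^^ Suc (k + i)) ((E ^^ i) v)) = (F ^^ Suc (k + i)) (E ((E ^^ i) v)) +
        coef (Suc (k + i)) (m + 2 * d * int i) *s (F ^^ (k + i)) ((E ^^ i) v)"
      using E_Fpow[OF Epow_wt[OF v(1)], of "Suc (k + i)"] by simp
    then show ?case
      using Suc by (simp add: endo.linear_0[OF E_linear] endo.linear_0[OF F_linear])
  qed (use v in simp)
  \<comment> \<open>Passing to E^j v raises the exponent by 2 d j but the required bound only by d
    j.\<close>
  have "0 \<le> d * int j" using d_pos by simp
  then have "m + 2 * d * int j \<ge> d * int (k + j)"
    using m by (simp add: algebra_simps)
  then have "(E ^^ j) v = 0"
    using highest_weight_Fpow[OF Epow_wt[OF v(1)] j(2) F0] by blast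
  then show False using j by simp
qed

text \<open>Surjectivity gives an \<open>x\<close> in \<open>W\<close> with the same image under
  F^(k+2) as E w, and injectivity of F^(k+2) identifies the two. The induction runs downwards on the
  absolute value of the exponent, starting beyond \<open>M\<close>, where the eigenspaces are
  zero.\<close>

lemma E_stable_if_Fpow_surj:
  assumes W: "subspace W" "W \<subseteq> V"
    and KW: "\<And>w. w \<in> W \<Longrightarrow> K w \<in> W" and FW: "\<And>w. w \<in> W \<Longrightarrow> F w \<in> W"
    and surj: "\<And>k y. y \<in> W \<Longrightarrow> y \<in> wt (- (d * int k)) \<Longrightarrow>
      \<exists>x. x \<in> W \<and> x \<in> wt (d * int k) \<and> (F ^^ k) x = y"
    and w: "w \<in> W"
  shows "E w \<in> W"
proof -
  have FkW: "(F ^^ k) w \<in> W" if "w \<in> W" for k w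
    using that FW by (induction k) auto
  obtain B where B: "\<forall>k::nat. k > B \<longrightarrow> d * int k \<notin> M \<and> - (d * int k) \<notin> M"
    using eventually_not_M[of 0] by auto
  define P where "P k \<longleftrightarrow> (\<forall>w\<in>W. w \<in> wt (d * int k) \<longrightarrow> E w \<in> W) \<and>
      (\<forall>w\<in>W. w \<in> wt (- (d * int k)) \<longrightarrow> E w \<in> W)" for k
  text \<open>For weight \<open>d k\<close>, \<open>E w\<close> is determined by \<open>F\<^sup>k\<^sup>+\<^sup>2 E w\<close>, which involves \<open>E\<close> only at weight
    \<open>-d (k + 4)\<close>; weight \<open>-d k\<close> reduces to weight \<open>d k\<close> by surjectivity.\<close>
  have P: "P k" for k
  proof (induction k rule: nat_descend_induct[of B])
    case (base k)
    then show ?case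
      using B wt_not_M endo.linear_0[OF E_linear] subspace_0[OF W(1)] unfolding P_def by metis
  next
    case (descend k)
    have pos: "E w \<in> W" if w: "w \<in> W" "w \<in> wt (d * int k)" for w
    proof -
      let ?y = "E ((F ^^ (k + 2)) w) - coef (k + 2) (d * int k) *s (F ^^ (k + 1)) w"
      have eq: "(F ^^ (k + 2)) (E w) = ?y"
        using E_Fpow[OF w(2), of "k + 2"] by simp
      have Ew: "E w \<in> wt (d * int (k + 2))"
        using E_wt[OF w(2)] by (simp add: algebra_simps)
      have "(F ^^ (k + 2)) w \<in> wt (- (d * int (k + 4)))"
        using Fpow_wt[OF w(2), of "k + 2"] by (simp add: algebra_simps)
      moreover have "P (k + 4)" by (rule descend.IH) simp
      ultimately have "E ((F ^^ (k + 2)) w) \<in> W"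
        using FkW[OF w(1)] unfolding P_def by blast
      then have "?y \<in> W"
        by (intro subspace_diff[OF W(1)] subspace_scale[OF W(1)] FkW[OF w(1)])
      moreover have "?y \<in> wt (- (d * int (k + 2)))"
        using Fpow_wt[OF Ew, of "k + 2"] unfolding eq by (simp add: algebra_simps)
      ultimately obtain x where x: "x \<in> W" "x \<in> wt (d * int (k + 2))" "(F ^^ (k + 2)) x = ?y"
        using surj by blast
      have "E w - x = 0"
      proof (rule Fpow_eq_0)
        show "E w - x \<in> wt (d * int (k + 2))"
          using Ew x wt_subspace by (intro subspace_diff) auto
        show "(F ^^ (k + 2)) (E w - x) = 0"
          unfolding endo.linear_diff[OF Fpow_linear] x(3) eq by simp
      qed simp
      then show ?thesis using x by simp
    qed
    have neg: "E w \<in> W" if w: "w \<in> W" "w \<in> wt (- (d * int k))" for w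
    proof -
      obtain x where x: "x \<in> W" "x \<in> wt (d * int k)" "(F ^^ k) x = w"
        using surj w by blast
      have "E w = (F ^^ k) (E x) + coef k (d * int k) *s (F ^^ (k - 1)) x"
        using E_Fpow[OF x(2)] x(3) by metis
      then show ?thesis
        using FkW pos x by (auto intro!: subspace_add[OF W(1)] subspace_scale[OF W(1)])
    qed
    show ?case using pos neg by (auto simp: P_def)
  qed
  have "E (Pr m w) \<in> W" for m
  proof (cases "Pr m w = 0")
    case True
    then show ?thesis using W by (simp add: endo.linear_0[OF E_linear] subspace_0)
  next
    case False
    have wV: "w \<in> V" using w W by blast
    \<comment> \<open>The predicate \<open>P\<close> only covers exponents that are multiples of
      \<open>d\<close>; by \<open>weight_multiple\<close> these are all that occur.\<close>
    have "d dvd m" using weight_multiple[OF Pr_wt[OF wV] False] .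
    then obtain l where l: "m = d * l" by blast
    have "m = d * int (nat \<bar>l\<bar>) \<or> m = - (d * int (nat \<bar>l\<bar>))"
      using l by (cases "l \<ge> 0") auto
    then show ?thesis
      using P[of "nat \<bar>l\<bar>"] Pr_mem[OF W(1) KW w wV] Pr_wt[OF wV, of m] unfolding P_def by metis
  qed
  then have "(\<Sum>m\<in>M. E (Pr m w)) \<in> W"
    using W by (intro subspace_sum) auto
  then show ?thesis
    using sum_Pr[of w] w W by (simp add: endo.linear_sum[OF E_linear, symmetric] subset_iff)
qed

end

text \<open>The sum of \<open>\<mu>\<close> over \<open>B\<close> is the exponent of the determinant
  of \<open>K\<close> on \<open>W\<close>. The basis is a parameter because a single joint
  eigenbasis is to serve all K_i.\<close>

locale weight_basis = quantum_sl2 +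
  fixes W B :: "'b set" and \<mu> :: "'b \<Rightarrow> int"
  assumes W_subspace: "subspace W" and W_V: "W \<subseteq> V"
    and K_W: "\<And>w. w \<in> W \<Longrightarrow> K w \<in> W" and F_W: "\<And>w. w \<in> W \<Longrightarrow> F w \<in> W"
    and finite_B: "finite B" and independent_B: "independent B" and B_W: "B \<subseteq> W"
    and W_span: "W \<subseteq> span B" and B_wt: "\<And>b. b \<in> B \<Longrightarrow> b \<in> wt (\<mu> b)"
begin

section \<open>Dimensions of the weight spaces of an \<open>F\<close>-stable subspace\<close>

definition level :: "int \<Rightarrow> 'b set" where
  "level e = {b \<in> B. \<mu> b = e}"

lemma finite_level: "finite (level e)"
  using finite_B by (simp add: level_def)

lemma independent_level: "independent (level e)"
  using independent_mono[OF independent_B] by (auto simp: level_def)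

text \<open>\<open>Pr e\<close> keeps exactly the basis vectors of exponent \<open>e\<close> in an
  expansion. Thus \<open>card (level e)\<close> is the dimension of the exponent \<open>e\<close>
  part of \<open>W\<close>.\<close>

lemma span_level: "span (level e) = W \<inter> wt e"
proof
  show "span (level e) \<subseteq> W \<inter> wt e"
    using B_W B_wt by (intro span_minimal subspace_inter W_subspace wt_subspace) (auto simp: level_def)
next
  show "W \<inter> wt e \<subseteq> span (level e)"
  proof
    fix w assume w: "w \<in> W \<inter> wt e"
    obtain r where r: "w = (\<Sum>b\<in>B. r b *s b)"
      using w W_span span_finite[OF finite_B] by auto
    have "w = Pr e w"
      using w Pr_eigen[of w e e] by (auto simp: wt_def)
    also have "\<dots> = (\<Sum>b\<in>B. r b *s Pr e b)"
      by (simp add: r endo.linear_sum[OF Pr_linear] endo.linear_scale[OF Pr_linear])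
    also have "\<dots> \<in> span (level e)"
    proof (intro span_sum span_scale)
      fix b assume b: "b \<in> B"
      then have "Pr e b = (if e = \<mu> b then b else 0)"
        using B_wt[OF b] Pr_eigen by (simp add: wt_def)
      then show "Pr e b \<in> span (level e)"
        using b by (auto simp: level_def span_zero intro: span_base)
    qed
    finally show "w \<in> span (level e)" .
  qed
qed

lemma Fpow_W: "w \<in> W \<Longrightarrow> (F ^^ k) w \<in> W"
  using F_W by (induction k) auto

lemma Fpow_inj_on: "inj_on (F ^^ k) (span (level (d * int k)))"
proof (rule inj_onI)
  fix x y assume "x \<in> span (level (d * int k))" "y \<in> span (level (d * int k))" "(F ^^ k) x = (F ^^ k) y"
  then have "x - y = 0"
    using Fpow_eq_0[of "x - y" "d * int k" k] subspace_diff[OF wt_subspace]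
    by (simp add: span_level endo.linear_diff[OF Fpow_linear])
  then show "x = y" by simp
qed

lemma Fpow_level:
  shows "independent ((F ^^ k) ` level (d * int k))"
    and "card ((F ^^ k) ` level (d * int k)) = card (level (d * int k))"
    and "(F ^^ k) ` level (d * int k) \<subseteq> span (level (- (d * int k)))"
proof -
  show "independent ((F ^^ k) ` level (d * int k))"
    by (rule endo.linear_independent_injective_image[OF Fpow_linear independent_level Fpow_inj_on])
  show "card ((F ^^ k) ` level (d * int k)) = card (level (d * int k))"
    using Fpow_inj_on by (intro card_image inj_on_subset[OF Fpow_inj_on] span_superset)
  show "(F ^^ k) ` level (d * int k) \<subseteq> span (level (- (d * int k)))"
  proof
    fix y assume "y \<in> (F ^^ k) ` level (d * int k)"
    then obtain b where b: "b \<in> level (d * int k)" "y = (F ^^ k) b" by blast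
    then have "b \<in> W \<inter> wt (d * int k)"
      using span_base[of b "level (d * int k)"] by (simp add: span_level)
    then show "y \<in> span (level (- (d * int k)))"
      using Fpow_W Fpow_wt[of b "d * int k" k] b(2) by (auto simp: span_level algebra_simps)
  qed
qed

text \<open>A nonempty level has exponent e = d k, and then F^k embeds the exponent d k part of
  \<open>W\<close> into the exponent -d k part.\<close>

lemma card_level_le:
  assumes "e \<ge> 0"
  shows "card (level e) \<le> card (level (- e))"
proof (cases "level e = {}")
  case False
  then obtain b where b: "b \<in> level e" by blast
  then have "b \<noteq> 0" using independent_level dependent_zero by blast
  then have "d dvd e"
    using weight_multiple[of b e] b B_wt by (auto simp: level_def)
  then obtain l where "e = d * l" by blast
  with assms d_pos have e: "e = d * int (nat l)"
    by (simp add: zero_le_mult_iff)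
  show ?thesis
    using independent_span_bound[OF finite_level Fpow_level(1,3)[of "nat l"]] Fpow_level(2)[of "nat l"]
    unfolding e by simp
qed simp

text \<open>The basis is grouped by exponent, and the resulting sum is added to its image under the
  substitution of \<open>- e\<close> for \<open>e\<close>. The bound \<open>R\<close> makes the
  range of exponents symmetric.\<close>

lemma sum_weights_twice:
  "2 * (\<Sum>b\<in>B. \<mu> b) =
     (\<Sum>e\<in>{-R..R}. e * (int (card (level e)) - int (card (level (- e)))))"
  if R: "\<And>b. b \<in> B \<Longrightarrow> \<bar>\<mu> b\<bar> \<le> R"
proof -
  have "(\<Sum>b\<in>B. \<mu> b) = (\<Sum>e\<in>{-R..R}. \<Sum>b\<in>{b \<in> B. \<mu> b = e}. \<mu> b)"
    using finite_B
    by (intro sum.group[symmetric]) (use R in \<open>force simp: abs_le_iff\<close>)+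
  also have "\<dots> = (\<Sum>e\<in>{-R..R}. e * int (card (level e)))"
    by (intro sum.cong) (auto simp: level_def mult.commute)
  finally have 1: "(\<Sum>b\<in>B. \<mu> b) = (\<Sum>e\<in>{-R..R}. e * int (card (level e)))" .
  also have "\<dots> = (\<Sum>e\<in>{-R..R}. - e * int (card (level (- e))))"
    by (rule sum.reindex_bij_witness[of _ uminus uminus]) auto
  finally show ?thesis
    using 1 by (simp add: right_diff_distrib sum_subtractf sum_negf)
qed

lemma level_term_nonpos: "e * (int (card (level e)) - int (card (level (- e)))) \<le> 0"
  using card_level_le[of e] card_level_le[of "- e"] by (cases "e \<ge> 0") (auto simp: mult_le_0_iff)

lemma weight_bound: "\<exists>R. \<forall>b\<in>B. \<bar>\<mu> b\<bar> \<le> R"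
  using bdd_above_finite[of "(\<lambda>b. \<bar>\<mu> b\<bar>) ` B"] finite_B by (auto simp: bdd_above_def)

lemma sum_weights_nonpos: "(\<Sum>b\<in>B. \<mu> b) \<le> 0"
proof -
  obtain R where "\<forall>b\<in>B. \<bar>\<mu> b\<bar> \<le> R" using weight_bound by blast
  then have "2 * (\<Sum>b\<in>B. \<mu> b) \<le> 0"
    using sum_weights_twice[of R] level_term_nonpos by (simp add: sum_nonpos)
  then show ?thesis by simp
qed

lemma card_level_eq:
  assumes "(\<Sum>b\<in>B. \<mu> b) = 0"
  shows "card (level e) = card (level (- e))"
proof -
  obtain R' where R': "\<forall>b\<in>B. \<bar>\<mu> b\<bar> \<le> R'" using weight_bound by blast
  \<comment> \<open>The range is enlarged to contain the given \<open>e\<close>, so that its term is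
    among the nonpositive terms with sum zero.\<close>
  define R where "R = max R' \<bar>e\<bar>"
  have R: "\<bar>\<mu> b\<bar> \<le> R" if "b \<in> B" for b using R' that by (auto simp: R_def)
  have "(\<Sum>e\<in>{-R..R}. - (e * (int (card (level e)) - int (card (level (- e)))))) = 0"
    using sum_weights_twice[of R] R assms by (simp add: sum_negf)
  moreover have "e \<in> {-R..R}" by (auto simp: R_def)
  ultimately have "e * (int (card (level e)) - int (card (level (- e)))) = 0"
    using level_term_nonpos
    by (subst (asm) sum_nonneg_eq_0_iff) (auto simp: neg_0_le_iff_le simp del: neg_le_0_iff_le)
  then show ?thesis by auto
qed

text \<open>Equality of the sum forces equal dimensions at \<open>e\<close> and \<open>- e\<close>,
  so the injections F^k between opposite weight spaces of \<open>W\<close> are onto and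
  \<open>E_stable_if_Fpow_surj\<close> applies.\<close>

lemma E_stable:
  assumes "(\<Sum>b\<in>B. \<mu> b) = 0" and w: "w \<in> W"
  shows "E w \<in> W"
proof (rule E_stable_if_Fpow_surj[OF W_subspace W_V K_W F_W _ w])
  fix k y assume y: "y \<in> W" "y \<in> wt (- (d * int k))"
  let ?T = "(F ^^ k) ` level (d * int k)"
  have "y \<in> span ?T"
  proof (rule ccontr)
    assume y': "y \<notin> span ?T"
    have "independent (insert y ?T)"
      using Fpow_level(1) y' by (simp add: independent_insert)
    moreover have "insert y ?T \<subseteq> span (level (- (d * int k)))"
      using y Fpow_level(3)[of k] by (simp add: span_level)
    ultimately have "card (insert y ?T) \<le> card (level (- (d * int k)))"
      using independent_span_bound[OF finite_level] by blast
    moreover have "y \<notin> ?T" using y' span_base by blast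
    ultimately show False
      using Fpow_level(2)[of k] card_level_eq[OF assms(1), of "d * int k"] finite_level by simp
  qed
  also have "span ?T = (F ^^ k) ` span (level (d * int k))"
    by (rule endo.linear_span_image[OF Fpow_linear])
  finally show "\<exists>x. x \<in> W \<and> x \<in> wt (d * int k) \<and> (F ^^ k) x = y"
    by (auto simp: span_level)
qed auto

end

section \<open>Level zero affine representations\<close>

text \<open>Here c_ij stands for d_i a_ij, the amount by which F_j lowers the exponent of K_i, and
  \<open>a\<close> for the coefficients of \<delta>. \<open>level_zero\<close> is the relation that
  the product of the K_i^(a_i) is 1, read on a joint eigenvector.\<close>

locale affine_rep = vector_space scale
  for scale :: "'k::field \<Rightarrow> 'b::ab_group_add \<Rightarrow> 'b" (infixr "*s" 75) +
  fixes V :: "'b set" and q :: 'k and n :: nat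
    and d :: "nat \<Rightarrow> int" and c :: "nat \<Rightarrow> nat \<Rightarrow> int" and a :: "nat \<Rightarrow> int" and \<kappa> :: "nat \<Rightarrow> 'k"
    and E F K :: "nat \<Rightarrow> 'b \<Rightarrow> 'b" and Pr :: "nat \<Rightarrow> int \<Rightarrow> 'b \<Rightarrow> 'b" and M :: "nat \<Rightarrow> int set"
  assumes sl2: "\<And>i. i \<le> n \<Longrightarrow> quantum_sl2 scale V q (K i) (Pr i) (M i) (E i) (F i) (d i) (\<kappa> i)"
    and V_finite: "\<exists>S. finite S \<and> V \<subseteq> span S"
    and F_V: "\<And>i v. i \<le> n \<Longrightarrow> v \<in> V \<Longrightarrow> F i v \<in> V"
    and K_V: "\<And>i v. i \<le> n \<Longrightarrow> v \<in> V \<Longrightarrow> K i v \<in> V"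
    and K_K: "\<And>i j v. i \<le> n \<Longrightarrow> j \<le> n \<Longrightarrow> v \<in> V \<Longrightarrow> K i (K j v) = K j (K i v)"
    and K_F: "\<And>i j m v. i \<le> n \<Longrightarrow> j \<le> n \<Longrightarrow> v \<in> V \<Longrightarrow> K i v = q powi m *s v \<Longrightarrow>
      K i (F j v) = q powi (m - c i j) *s F j v"
    and a_pos: "\<And>i. i \<le> n \<Longrightarrow> a i > 0"
    and level_zero: "\<And>v \<mu>. v \<in> V \<Longrightarrow> v \<noteq> 0 \<Longrightarrow> (\<And>i. i \<le> n \<Longrightarrow> K i v = q powi (\<mu> i) *s v) \<Longrightarrow>
      (\<Sum>i\<le>n. a i * \<mu> i) = 0"
begin

text \<open>Simultaneous diagonalisation, one K_j at a time: each joint eigenvector of the earlier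
  K_i is split by \<open>Pr j\<close>.\<close>

lemma span_joint_eigenvectors:
  assumes W: "subspace W" "W \<subseteq> V" and KW: "\<And>i w. i \<le> n \<Longrightarrow> w \<in> W \<Longrightarrow> K i w \<in> W" and "j \<le> Suc n"
  shows "W \<subseteq> span {w \<in> W. \<exists>\<mu>. \<forall>i<j. K i w = q powi (\<mu> i) *s w}"
  using \<open>j \<le> Suc n\<close>
proof (induction j)
  case 0
  show ?case using span_superset by auto
next
  case (Suc j)
  then have j: "j \<le> n" by simp
  interpret Q: quantum_sl2 scale V q "K j" "Pr j" "M j" "E j" "F j" "d j" "\<kappa> j"
    by (rule sl2[OF j])
  let ?J = "\<lambda>j. {w \<in> W. \<exists>\<mu>. \<forall>i<j. K i w = q powi (\<mu> i) *s w}"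
  have "?J j \<subseteq> span (?J (Suc j))"
  proof
    fix s assume "s \<in> ?J j"
    then obtain \<mu> where s: "s \<in> W" "\<forall>i<j. K i s = q powi (\<mu> i) *s s" by blast
    have sV: "s \<in> V" using s W by blast
    \<comment> \<open>This joint eigenspace is stable under K_j because the K_i commute, so
      \<open>Pr_mem\<close> keeps the components of \<open>s\<close> in it.\<close>
    let ?U = "{w \<in> W. \<forall>i<j. K i w = q powi (\<mu> i) *s w}"
    have lin: "Vector_Spaces.linear scale scale (K i)" if "i < j" for i
    proof -
      interpret Qi: quantum_sl2 scale V q "K i" "Pr i" "M i" "E i" "F i" "d i" "\<kappa> i"
        using that j by (intro sl2) simp
      show ?thesis by (rule Qi.K_linear)
    qed
    have "subspace ?U"
      using W(1) lin unfolding subspace_def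
      by (auto simp: Q.endo.linear_0 Q.endo.linear_add Q.endo.linear_scale scale_right_distrib mult.commute)
    moreover have "K j w \<in> ?U" if "w \<in> ?U" for w
    proof -
      have "K i (K j w) = q powi (\<mu> i) *s K j w" if "i < j" for i
      proof -
        have "K i (K j w) = K j (K i w)"
          using that \<open>w \<in> ?U\<close> W j by (intro K_K) auto
        then show ?thesis
          using that \<open>w \<in> ?U\<close> Q.endo.linear_scale[OF Q.K_linear] by simp
      qed
      then show ?thesis using KW j that by auto
    qed
    ultimately have "Pr j m s \<in> ?U" for m
      using Q.Pr_mem[of ?U s m] s sV by blast
    then have "Pr j m s \<in> ?J (Suc j)" for m
      using Q.K_Pr[OF sV, of m] by (auto simp: less_Suc_eq intro!: exI[of _ "\<mu>(j := m)"])
    then have "(\<Sum>m\<in>M j. Pr j m s) \<in> span (?J (Suc j))"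
      by (intro span_sum span_base)
    then show "s \<in> span (?J (Suc j))"
      using Q.sum_Pr[OF sV] by simp
  qed
  then have "span (?J j) \<subseteq> span (?J (Suc j))"
    by (intro span_minimal subspace_span)
  then show ?case using Suc by auto
qed

text \<open>On a common eigenbasis the determinant exponents of the different K_i can be compared:
  each is at most zero, while their combination with the positive coefficients \<open>a i\<close> is
  zero. All therefore vanish, and \<open>weight_basis.E_stable\<close> applies to every
  \<open>i\<close>.\<close>

lemma graded_E_stable:
  assumes W: "subspace W" "W \<subseteq> V"
    and KW: "\<And>i w. i \<le> n \<Longrightarrow> w \<in> W \<Longrightarrow> K i w \<in> W" and FW: "\<And>i w. i \<le> n \<Longrightarrow> w \<in> W \<Longrightarrow> F i w \<in> W"
    and iw: "i \<le> n" "w \<in> W"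
  shows "E i w \<in> W"
proof -
  obtain B where B: "B \<subseteq> {w \<in> W. \<exists>\<mu>. \<forall>i<Suc n. K i w = q powi (\<mu> i) *s w}" "independent B"
      "{w \<in> W. \<exists>\<mu>. \<forall>i<Suc n. K i w = q powi (\<mu> i) *s w} \<subseteq> span B"
    using maximal_independent_subset .
  then have BW: "B \<subseteq> W" by blast
  have W_span: "W \<subseteq> span B"
    using span_joint_eigenvectors[OF W KW, of "Suc n"] span_minimal[OF B(3) subspace_span] by auto
  have finB: "finite B"
    using V_finite independent_span_bound[OF _ B(2)] BW W(2) by blast
  have "\<forall>b\<in>B. \<exists>\<mu>. \<forall>i<Suc n. K i b = q powi (\<mu> i) *s b"
    using B(1) by blast
  then obtain \<mu> where \<mu>: "\<And>b i. b \<in> B \<Longrightarrow> i \<le> n \<Longrightarrow> K i b = q powi (\<mu> b i) *s b"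
    unfolding less_Suc_eq_le by metis
  have basis: "weight_basis scale V q (K i) (Pr i) (M i) (E i) (F i) (d i) (\<kappa> i) W B (\<lambda>b. \<mu> b i)"
    if i: "i \<le> n" for i
  proof -
    interpret Q: quantum_sl2 scale V q "K i" "Pr i" "M i" "E i" "F i" "d i" "\<kappa> i"
      by (rule sl2[OF i])
    show ?thesis
      by unfold_locales (use W KW FW i finB B(2) BW W_span \<mu> in \<open>auto simp: Q.wt_def\<close>)
  qed
  have nonpos: "(\<Sum>b\<in>B. \<mu> b i) \<le> 0" if "i \<le> n" for i
    by (rule weight_basis.sum_weights_nonpos[OF basis[OF that]])
  \<comment> \<open>After the exchange of sums, \<open>level_zero\<close> applies to each basis
    vector separately.\<close>
  have "(\<Sum>i\<le>n. a i * (\<Sum>b\<in>B. \<mu> b i)) = (\<Sum>b\<in>B. \<Sum>i\<le>n. a i * \<mu> b i)"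
    by (subst sum.swap) (simp add: sum_distrib_left)
  also have "\<dots> = 0"
  proof (rule sum.neutral, rule ballI)
    fix b assume b: "b \<in> B"
    then have "b \<noteq> 0" using B(2) dependent_zero by blast
    then show "(\<Sum>i\<le>n. a i * \<mu> b i) = 0"
      using level_zero \<mu>[OF b] b BW W(2) by blast
  qed
  finally have "(\<Sum>i\<le>n. - (a i * (\<Sum>b\<in>B. \<mu> b i))) = 0"
    by (simp add: sum_negf)
  then have "\<forall>i\<in>{..n}. - (a i * (\<Sum>b\<in>B. \<mu> b i)) = 0"
    using nonpos a_pos by (subst (asm) sum_nonneg_eq_0_iff) (auto simp: mult_nonneg_nonpos less_imp_le)
  then have "(\<Sum>b\<in>B. \<mu> b i) = 0"
    using iw(1) a_pos[of i] by force
  then show ?thesis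
    using weight_basis.E_stable[OF basis[OF iw(1)]] iw(2) by blast
qed

text \<open>\<open>gr\<close> is applied for each K_j in turn. Stability under the F_i and the
  earlier K_i survives, since these maps are homogeneous for the K_j-grading: F_i lowers degrees by
  \<open>c j i\<close> and K_i preserves them.\<close>

lemma degenerate_to_graded:
  assumes W: "subspace W" "W \<subseteq> V" and FW: "\<And>i w. i \<le> n \<Longrightarrow> w \<in> W \<Longrightarrow> F i w \<in> W"
    and "j \<le> Suc n"
  shows "\<exists>U. subspace U \<and> U \<subseteq> V \<and> (\<forall>i\<le>n. \<forall>u\<in>U. F i u \<in> U) \<and> (\<forall>i<j. \<forall>u\<in>U. K i u \<in> U) \<and>
    (U = {0} \<longrightarrow> W = {0}) \<and> (U = V \<longrightarrow> W = V)"
  using \<open>j \<le> Suc n\<close>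
proof (induction j)
  case 0
  show ?case using W FW by blast
next
  case (Suc j)
  then have j: "j \<le> n" by simp
  obtain U where U: "subspace U" "U \<subseteq> V" "\<And>i u. i \<le> n \<Longrightarrow> u \<in> U \<Longrightarrow> F i u \<in> U"
      "\<And>i u. i < j \<Longrightarrow> u \<in> U \<Longrightarrow> K i u \<in> U" "U = {0} \<Longrightarrow> W = {0}" "U = V \<Longrightarrow> W = V"
    using Suc.IH Suc_leD[OF Suc.prems] by blast
  interpret Q: quantum_sl2 scale V q "K j" "Pr j" "M j" "E j" "F j" "d j" "\<kappa> j"
    by (rule sl2[OF j])
  have "F i u \<in> Q.gr U" if "i \<le> n" "u \<in> Q.gr U" for i u
  proof -
    interpret Qi: quantum_sl2 scale V q "K i" "Pr i" "M i" "E i" "F i" "d i" "\<kappa> i"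
      using that by (intro sl2)
    show ?thesis
      by (rule Q.gr_shift[OF Qi.F_linear F_V _ U(2,3)])
         (use that j K_F F_V in \<open>auto simp: Q.wt_def\<close>)
  qed
  moreover have "K i u \<in> Q.gr U" if i: "i < Suc j" and u: "u \<in> Q.gr U" for i u
  proof (cases "i = j")
    case True
    then show ?thesis using Q.gr_K[OF U(1) u] by simp
  next
    case False
    then have i: "i < j" "i \<le> n" using i j by auto
    interpret Qi: quantum_sl2 scale V q "K i" "Pr i" "M i" "E i" "F i" "d i" "\<kappa> i"
      using i by (intro sl2)
    show ?thesis
    proof (rule Q.gr_shift[OF Qi.K_linear K_V[OF i(2)] _ U(2) U(4)[OF i(1)] u])
      fix m v assume "v \<in> Q.wt m"
      then show "K i v \<in> Q.wt (m - 0)"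
        using K_K[OF j i(2)] K_V[OF i(2)] Q.endo.linear_scale[OF Qi.K_linear] by (simp add: Q.wt_def)
    qed auto
  qed
  ultimately have "(\<forall>i\<le>n. \<forall>u\<in>Q.gr U. F i u \<in> Q.gr U) \<and> (\<forall>i<Suc j. \<forall>u\<in>Q.gr U. K i u \<in> Q.gr U)"
    by blast
  moreover have "Q.gr U = {0} \<longrightarrow> W = {0}" "Q.gr U = V \<longrightarrow> W = V"
    using Q.gr_eq_0[OF U(1,2)] Q.gr_eq_V[OF U(1,2)] U(5,6) by blast+
  ultimately show ?case
    using Q.gr_subspace[OF U(1)] Q.gr_V[of U] by (intro exI[of _ "Q.gr U"] conjI) simp_all
qed

text \<open>The graded degeneration of \<open>W\<close> is stable under all E_i, F_i and K_i, hence
  trivial by \<open>irr\<close>; the two implications kept in \<open>degenerate_to_graded\<close>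
  bring this back to \<open>W\<close>.\<close>

theorem F_irreducible:
  assumes irr: "\<And>U. subspace U \<Longrightarrow> U \<subseteq> V \<Longrightarrow>
      (\<And>i u. i \<le> n \<Longrightarrow> u \<in> U \<Longrightarrow> E i u \<in> U \<and> F i u \<in> U \<and> K i u \<in> U) \<Longrightarrow> U = {0} \<or> U = V"
    and W: "subspace W" "W \<subseteq> V" and FW: "\<And>i w. i \<le> n \<Longrightarrow> w \<in> W \<Longrightarrow> F i w \<in> W"
  shows "W = {0} \<or> W = V"
proof -
  obtain U where U: "subspace U" "U \<subseteq> V" "\<And>i u. i \<le> n \<Longrightarrow> u \<in> U \<Longrightarrow> F i u \<in> U"
      "\<And>i u. i \<le> n \<Longrightarrow> u \<in> U \<Longrightarrow> K i u \<in> U" "U = {0} \<Longrightarrow> W = {0}" "U = V \<Longrightarrow> W = V"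
    using degenerate_to_graded[OF W FW, of "Suc n"] unfolding less_Suc_eq_le by blast
  have "U = {0} \<or> U = V"
    using U(3,4) graded_E_stable[OF U(1,2,4,3)] by (intro irr U) auto
  then show ?thesis using U(5,6) by blast
qed

end

section \<open>Matrices acting on coordinate functions\<close>

definition fscale :: "'k::field \<Rightarrow> (nat \<Rightarrow> 'k) \<Rightarrow> nat \<Rightarrow> 'k" where
  "fscale c f = (\<lambda>i. c * f i)"

interpretation fn: vector_space "fscale :: 'k::field \<Rightarrow> (nat \<Rightarrow> 'k) \<Rightarrow> nat \<Rightarrow> 'k"
  by unfold_locales (auto simp: fscale_def fun_eq_iff algebra_simps)

text \<open>Vectors are embedded into \<^typ>\<open>nat \<Rightarrow> 'k\<close>, extended by zero, because \<^locale>\<open>vector_space\<close>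
  needs the vectors to form a type with total addition.\<close>

definition fvec :: "'k::field vec \<Rightarrow> nat \<Rightarrow> 'k" where
  "fvec v = (\<lambda>i. if i < dim_vec v then v $ i else 0)"

definition fspace :: "nat \<Rightarrow> (nat \<Rightarrow> 'k::field) set" where
  "fspace N = {f. \<forall>i\<ge>N. f i = 0}"

text \<open>The argument is cut off to its first \<open>N\<close> entries before \<open>T\<close> is
  applied, so linearity of \<open>T\<close> on \<open>carrier_vec N\<close> gives linearity on all
  functions.\<close>

definition fop :: "nat \<Rightarrow> ('k::field vec \<Rightarrow> 'k vec) \<Rightarrow> (nat \<Rightarrow> 'k) \<Rightarrow> nat \<Rightarrow> 'k" where
  "fop N T f = fvec (T (vec N f))"

definition linear_vec :: "nat \<Rightarrow> ('k::field vec \<Rightarrow> 'k vec) \<Rightarrow> bool" where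
  "linear_vec N T \<longleftrightarrow> (\<forall>v\<in>carrier_vec N. T v \<in> carrier_vec N) \<and>
     (\<forall>v\<in>carrier_vec N. \<forall>w\<in>carrier_vec N. T (v + w) = T v + T w) \<and>
     (\<forall>c. \<forall>v\<in>carrier_vec N. T (c \<cdot>\<^sub>v v) = c \<cdot>\<^sub>v T v)"

lemma fvec_fspace: "v \<in> carrier_vec N \<Longrightarrow> fvec v \<in> fspace N"
  by (auto simp: fvec_def fspace_def)

lemma vec_fvec: "v \<in> carrier_vec N \<Longrightarrow> vec N (fvec v) = v"
  by (auto simp: fvec_def)

lemma fvec_vec: "f \<in> fspace N \<Longrightarrow> fvec (vec N f) = f"
  by (auto simp: fvec_def fspace_def fun_eq_iff)

lemma fvec_eq_iff: "v \<in> carrier_vec N \<Longrightarrow> w \<in> carrier_vec N \<Longrightarrow> fvec v = fvec w \<longleftrightarrow> v = w"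
  by (metis vec_fvec)

lemma fvec_add: "v \<in> carrier_vec N \<Longrightarrow> w \<in> carrier_vec N \<Longrightarrow> fvec (v + w) = fvec v + fvec w"
  by (auto simp: fvec_def fun_eq_iff)

lemma fvec_smult: "fvec (c \<cdot>\<^sub>v v) = fscale c (fvec v)"
  by (auto simp: fvec_def fscale_def fun_eq_iff)

lemma fvec_zero: "fvec (0\<^sub>v N) = 0"
  by (auto simp: fvec_def fun_eq_iff)

lemma vec_add_fun: "vec N (f + g) = vec N f + vec N g"
  by auto

lemma vec_fscale: "vec N (fscale c f) = c \<cdot>\<^sub>v vec N f"
  by (auto simp: fscale_def)

lemma fop_fvec: "v \<in> carrier_vec N \<Longrightarrow> fop N T (fvec v) = fvec (T v)"
  by (simp add: fop_def vec_fvec)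

lemma fspace_cases:
  assumes "f \<in> fspace N"
  obtains v where "v \<in> carrier_vec N" "f = fvec v"
  using that[of "vec N f"] fvec_vec[OF assms] by simp

lemma fspace_subspace: "fn.subspace (fspace N)"
  by (auto simp: fn.subspace_def fspace_def fscale_def)

lemma fspace_finite: "\<exists>S. finite S \<and> fspace N \<subseteq> fn.span S"
proof (intro exI conjI subsetI)
  let ?e = "\<lambda>a i. if i = a then 1 else (0 :: 'a)"
  show "finite (?e ` {..<N})" by simp
  fix f :: "nat \<Rightarrow> 'a" assume f: "f \<in> fspace N"
  have "(\<Sum>a<N. fscale (f a) (?e a)) i = f i" for i
  proof -
    have "(\<Sum>a<N. fscale (f a) (?e a)) i = (\<Sum>a<N. fscale (f a) (?e a) i)"
      by (induction N) auto
    also have "\<dots> = (\<Sum>a<N. if a = i then f i else 0)"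
      by (intro sum.cong) (auto simp: fscale_def)
    also have "\<dots> = f i" using f by (auto simp: fspace_def)
    finally show ?thesis .
  qed
  then have "f = (\<Sum>a<N. fscale (f a) (?e a))" by (simp add: fun_eq_iff)
  also have "\<dots> \<in> fn.span (?e ` {..<N})"
    by (intro fn.span_sum fn.span_scale fn.span_base) auto
  finally show "f \<in> fn.span (?e ` {..<N})" .
qed

lemma linear_fop:
  assumes "linear_vec N T"
  shows "Vector_Spaces.linear fscale fscale (fop N T)"
proof -
  interpret pair: vector_space_pair "fscale :: 'a \<Rightarrow> _" "fscale :: 'a \<Rightarrow> _" ..
  have "fop N T (f + g) = fop N T f + fop N T g" for f g
    using assms unfolding fop_def vec_add_fun linear_vec_def by (metis fvec_add vec_carrier)
  moreover have "fop N T (fscale c f) = fscale c (fop N T f)" for c f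
    using assms unfolding fop_def vec_fscale linear_vec_def by (metis fvec_smult vec_carrier)
  ultimately show ?thesis
    by unfold_locales auto
qed

lemma linear_vec_mult_mat: "A \<in> carrier_mat N N \<Longrightarrow> linear_vec N ((*\<^sub>v) A)"
  by (auto simp: linear_vec_def mult_add_distrib_mat_vec mult_mat_vec)

lemma subspace_vec_fun:
  assumes "is_subspace N W"
  shows "fn.subspace (fvec ` W)"
proof -
  have W: "W \<subseteq> carrier_vec N" "0\<^sub>v N \<in> W" "\<And>v w. v \<in> W \<Longrightarrow> w \<in> W \<Longrightarrow> v + w \<in> W"
    "\<And>c v. v \<in> W \<Longrightarrow> c \<cdot>\<^sub>v v \<in> W"
    using assms by (auto simp: is_subspace_def)
  show ?thesis
    unfolding fn.subspace_def
  proof (intro conjI ballI allI)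
    show "0 \<in> fvec ` W" using W(2) fvec_zero by (metis imageI)
  next
    fix x y assume "x \<in> fvec ` W" "y \<in> fvec ` W"
    then obtain v w where "v \<in> W" "w \<in> W" "x = fvec v" "y = fvec w" by blast
    moreover from this have "x + y = fvec (v + w)" using fvec_add W(1) by (metis subsetD)
    ultimately show "x + y \<in> fvec ` W" using W(3) by blast
  next
    fix c x assume "x \<in> fvec ` W"
    then show "fscale c x \<in> fvec ` W" using W(4) by (auto simp flip: fvec_smult)
  qed
qed

lemma subspace_fun_vec:
  assumes "fn.subspace U"
  shows "is_subspace N {v \<in> carrier_vec N. fvec v \<in> U}"
  using assms
  by (auto simp: is_subspace_def fvec_zero fvec_smult fvec_add[of _ N] fn.subspace_0 fn.subspace_add fn.subspace_scale)

lemma gen_alg_carrier: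
  assumes "M \<in> gen_alg N G" "G \<subseteq> carrier_mat N N"
  shows "M \<in> carrier_mat N N"
  using assms by (induction rule: gen_alg.induct) auto

lemma gen_alg_stable:
  assumes "M \<in> gen_alg N G" and G: "G \<subseteq> carrier_mat N N" and W: "is_subspace N W"
    and GW: "\<And>g w. g \<in> G \<Longrightarrow> w \<in> W \<Longrightarrow> g *\<^sub>v w \<in> W" and w: "w \<in> W"
  shows "M *\<^sub>v w \<in> W"
  using assms(1) w
proof (induction arbitrary: w rule: gen_alg.induct)
  case one
  then show ?case using W by (auto simp: is_subspace_def)
next
  case (gen g)
  then show ?case using GW by blast
next
  case (add M M')
  then have "w \<in> carrier_vec N" using W by (auto simp: is_subspace_def)
  then have "(M + M') *\<^sub>v w = M *\<^sub>v w + M' *\<^sub>v w"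
    using add gen_alg_carrier[OF _ G] by (intro add_mult_distrib_mat_vec) auto
  then show ?case using add W by (auto simp: is_subspace_def)
next
  case (mult M M')
  then have "w \<in> carrier_vec N" using W by (auto simp: is_subspace_def)
  then have "(M * M') *\<^sub>v w = M *\<^sub>v (M' *\<^sub>v w)"
    using mult.hyps gen_alg_carrier[OF _ G] by (intro assoc_mult_mat_vec[of _ N N _ N])
  then show ?case using mult by simp
next
  case (smult M c)
  then have "w \<in> carrier_vec N" using W by (auto simp: is_subspace_def)
  then have "(c \<cdot>\<^sub>m M) *\<^sub>v w = c \<cdot>\<^sub>v (M *\<^sub>v w)"
    using smult gen_alg_carrier[OF smult.hyps G] by (intro eq_vecI) auto
  then show ?case using smult W by (auto simp: is_subspace_def)
qed

section \<open>Eigenprojections of a diagonalised matrix\<close>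

definition degree_part :: "nat \<Rightarrow> (nat \<Rightarrow> int) \<Rightarrow> int \<Rightarrow> 'k::field vec \<Rightarrow> 'k vec" where
  "degree_part N ex m u = vec N (\<lambda>a. if ex a = m then u $ a else 0)"

text \<open>The columns of \<open>P\<close> form an eigenbasis; in its coordinates this is the
  projection onto the positions whose exponent is \<open>m\<close>.\<close>

definition eigenproj :: "nat \<Rightarrow> 'k::field mat \<Rightarrow> 'k mat \<Rightarrow> (nat \<Rightarrow> int) \<Rightarrow> int \<Rightarrow> 'k vec \<Rightarrow> 'k vec" where
  "eigenproj N P Pinv ex m v = P *\<^sub>v degree_part N ex m (Pinv *\<^sub>v v)"

locale diagonalised =
  fixes N :: nat and q :: "'k::field" and K P Pinv D :: "'k mat" and ex :: "nat \<Rightarrow> int"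
  assumes q_nonzero: "q \<noteq> 0" and q_not_root: "\<And>m::int. q powi m = 1 \<Longrightarrow> m = 0"
    and P: "P \<in> carrier_mat N N" and Pinv: "Pinv \<in> carrier_mat N N" and D: "D \<in> carrier_mat N N"
    and P_Pinv: "P * Pinv = 1\<^sub>m N" and Pinv_P: "Pinv * P = 1\<^sub>m N"
    and D_off: "\<And>a b. a < N \<Longrightarrow> b < N \<Longrightarrow> a \<noteq> b \<Longrightarrow> D $$ (a, b) = 0"
    and D_diag: "\<And>a. a < N \<Longrightarrow> D $$ (a, a) = q powi ex a"
    and K_eq: "K = P * D * Pinv"
begin

lemma K: "K \<in> carrier_mat N N"
  unfolding K_eq using P Pinv D by (intro mult_carrier_mat)

lemma degree_part_carrier: "degree_part N ex m u \<in> carrier_vec N"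
  by (simp add: degree_part_def)

lemma P_Pinv_vec: "v \<in> carrier_vec N \<Longrightarrow> P *\<^sub>v (Pinv *\<^sub>v v) = v"
  using assoc_mult_mat_vec[OF P Pinv, of v] by (simp add: P_Pinv)

lemma Pinv_P_vec: "v \<in> carrier_vec N \<Longrightarrow> Pinv *\<^sub>v (P *\<^sub>v v) = v"
  using assoc_mult_mat_vec[OF Pinv P, of v] by (simp add: Pinv_P)

lemma D_vec:
  assumes u: "u \<in> carrier_vec N" and a: "a < N"
  shows "(D *\<^sub>v u) $ a = q powi ex a * u $ a"
proof -
  have "(D *\<^sub>v u) $ a = (\<Sum>b\<in>{0..<N}. D $$ (a, b) * u $ b)"
    using D u a by (simp add: scalar_prod_def)
  also have "\<dots> = (\<Sum>b\<in>{0..<N}. if b = a then q powi ex a * u $ a else 0)"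
    using D_off D_diag a by (intro sum.cong) auto
  finally show ?thesis using a by simp
qed

lemma K_vec: "v \<in> carrier_vec N \<Longrightarrow> K *\<^sub>v v = P *\<^sub>v (D *\<^sub>v (Pinv *\<^sub>v v))"
  using P Pinv D by (simp add: K_eq assoc_mult_mat_vec[of _ N N _ N])

lemma linear_vec_eigenproj: "linear_vec N (eigenproj N P Pinv ex m)"
proof -
  have "degree_part N ex m (u + w) = degree_part N ex m u + degree_part N ex m w"
    if "u \<in> carrier_vec N" "w \<in> carrier_vec N" for u w :: "'k vec"
    using that by (intro eq_vecI) (auto simp: degree_part_def)
  moreover have "degree_part N ex m (c \<cdot>\<^sub>v u) = c \<cdot>\<^sub>v degree_part N ex m u" if "u \<in> carrier_vec N" for c and u :: "'k vec"
    using that by (intro eq_vecI) (auto simp: degree_part_def)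
  ultimately show ?thesis
    by (auto simp: degree_part_carrier linear_vec_def eigenproj_def mult_add_distrib_mat_vec[OF Pinv] mult_mat_vec[OF Pinv]
        mult_add_distrib_mat_vec[OF P] mult_mat_vec[OF P] mult_mat_vec_carrier[OF P] mult_mat_vec_carrier[OF Pinv])
qed

lemma K_eigenproj:
  assumes v: "v \<in> carrier_vec N"
  shows "K *\<^sub>v eigenproj N P Pinv ex m v = q powi m \<cdot>\<^sub>v eigenproj N P Pinv ex m v"
proof -
  have "D *\<^sub>v degree_part N ex m u = q powi m \<cdot>\<^sub>v degree_part N ex m u" for u :: "'k vec"
  proof (rule eq_vecI)
    fix a assume "a < dim_vec (q powi m \<cdot>\<^sub>v degree_part N ex m u)"
    then have a: "a < N" by (simp add: degree_part_def)
    show "(D *\<^sub>v degree_part N ex m u) $ a = (q powi m \<cdot>\<^sub>v degree_part N ex m u) $ a"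
      unfolding D_vec[OF degree_part_carrier a] using a by (simp add: degree_part_def)
  qed (use D in \<open>simp add: degree_part_def\<close>)
  then show ?thesis
    by (simp add: eigenproj_def K_vec Pinv_P_vec degree_part_carrier mult_mat_vec_carrier[OF P]
        mult_mat_vec[OF P degree_part_carrier])
qed

text \<open>In eigenbasis coordinates the equation D u = q^m u forces \<open>u\<close> to be
  supported on positions of exponent \<open>m\<close>, as distinct exponents give distinct powers of
  \<open>q\<close>.\<close>

lemma eigenproj_eigenvector:
  assumes v: "v \<in> carrier_vec N" "K *\<^sub>v v = q powi m \<cdot>\<^sub>v v"
  shows "eigenproj N P Pinv ex l v = (if l = m then v else 0\<^sub>v N)"
proof -
  define u where "u = Pinv *\<^sub>v v"
  have u: "u \<in> carrier_vec N" using Pinv v by (simp add: u_def)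
  have "D *\<^sub>v u = Pinv *\<^sub>v (K *\<^sub>v v)"
    using D u by (simp add: K_vec[OF v(1)] u_def Pinv_P_vec)
  also have "\<dots> = q powi m \<cdot>\<^sub>v u"
    using mult_mat_vec[OF Pinv v(1)] by (simp add: v(2) u_def)
  finally have Du: "D *\<^sub>v u = q powi m \<cdot>\<^sub>v u" .
  have ua: "u $ a = 0 \<or> ex a = m" if "a < N" for a
  proof -
    have "q powi ex a * u $ a = q powi m * u $ a"
      using arg_cong[OF Du, of "\<lambda>w. w $ a"] D_vec[OF u that] u that by simp
    then have "u $ a = 0 \<or> q powi (ex a - m) = 1"
      using q_nonzero by (auto simp: power_int_diff)
    then show ?thesis using q_not_root by fastforce
  qed
  have "degree_part N ex l u = (if l = m then u else 0\<^sub>v N)"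
    using u by (intro eq_vecI) (auto simp: degree_part_def dest: ua)
  then show ?thesis
    using v(1) P P_Pinv_vec by (auto simp: eigenproj_def u_def)
qed

text \<open>Each position \<open>b\<close> contributes for the single exponent \<open>ex b\<close>,
  so exchanging the sums leaves the entry of P Pinv v.\<close>

lemma sum_eigenproj:
  assumes v: "v \<in> carrier_vec N" and a: "a < N"
  shows "(\<Sum>m\<in>ex ` {..<N}. eigenproj N P Pinv ex m v $ a) = v $ a"
proof -
  define u where "u = Pinv *\<^sub>v v"
  have u: "u \<in> carrier_vec N" using Pinv v by (simp add: u_def)
  have "(\<Sum>m\<in>ex ` {..<N}. eigenproj N P Pinv ex m v $ a) =
      (\<Sum>m\<in>ex ` {..<N}. \<Sum>b\<in>{0..<N}. P $$ (a, b) * (if ex b = m then u $ b else 0))"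
    using P a by (intro sum.cong) (auto simp: eigenproj_def u_def[symmetric] degree_part_def scalar_prod_def)
  also have "\<dots> = (\<Sum>b\<in>{0..<N}. \<Sum>m\<in>ex ` {..<N}. P $$ (a, b) * (if ex b = m then u $ b else 0))"
    by (rule sum.swap)
  also have "\<dots> = (\<Sum>b\<in>{0..<N}. P $$ (a, b) * u $ b)"
  proof (rule sum.cong)
    fix b assume "b \<in> {0..<N}"
    then have "(\<Sum>m\<in>ex ` {..<N}. if ex b = m then u $ b else 0) = u $ b"
      by auto
    then show "(\<Sum>m\<in>ex ` {..<N}. P $$ (a, b) * (if ex b = m then u $ b else 0)) = P $$ (a, b) * u $ b"
      by (simp only: sum_distrib_left[symmetric])
  qed simp
  also have "\<dots> = (P *\<^sub>v u) $ a"
    using P u a by (simp add: scalar_prod_def)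
  finally show ?thesis using P_Pinv_vec[OF v] by (simp add: u_def)
qed

lemma eigenspace_decomposition_fop:
  "eigenspace_decomposition fscale (fspace N) q (fop N ((*\<^sub>v) K))
     (\<lambda>m. fop N (eigenproj N P Pinv ex m)) (ex ` {..<N})"
proof (intro eigenspace_decomposition.intro eigenspace_decomposition_axioms.intro)
  show "vector_space (fscale :: 'k \<Rightarrow> (nat \<Rightarrow> 'k) \<Rightarrow> nat \<Rightarrow> 'k)" by (rule fn.vector_space_axioms)
  show "fn.subspace (fspace N)" by (rule fspace_subspace)
  show "Vector_Spaces.linear fscale fscale (fop N ((*\<^sub>v) K))"
    by (rule linear_fop[OF linear_vec_mult_mat[OF K]])
  show "Vector_Spaces.linear fscale fscale (fop N (eigenproj N P Pinv ex m))" for m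
    by (rule linear_fop[OF linear_vec_eigenproj])
  fix m and f :: "nat \<Rightarrow> 'k" assume "f \<in> fspace N"
  then obtain v where v: "v \<in> carrier_vec N" "f = fvec v" by (rule fspace_cases)
  have proj: "eigenproj N P Pinv ex m v \<in> carrier_vec N" for m
    using linear_vec_eigenproj v(1) by (simp add: linear_vec_def)
  show "fop N (eigenproj N P Pinv ex m) f \<in> fspace N"
    by (simp add: v fop_fvec fvec_fspace proj)
  show "fop N ((*\<^sub>v) K) (fop N (eigenproj N P Pinv ex m) f) = fscale (q powi m) (fop N (eigenproj N P Pinv ex m) f)"
    by (simp add: v fop_fvec proj K_eigenproj fvec_smult)
  show "(\<Sum>m\<in>ex ` {..<N}. fop N (eigenproj N P Pinv ex m) f) = f"
  proof
    fix i
    have "(\<Sum>m\<in>S. fop N (eigenproj N P Pinv ex m) f) i = (\<Sum>m\<in>S. fop N (eigenproj N P Pinv ex m) f i)"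
      if "finite S" for S
      using that by (induction S rule: finite_induct) auto
    then show "(\<Sum>m\<in>ex ` {..<N}. fop N (eigenproj N P Pinv ex m) f) i = f i"
      using v(1) sum_eigenproj[OF v(1), of i] carrier_vecD[OF proj]
      unfolding v(2) fop_fvec[OF v(1)] by (simp add: fvec_def)
  qed
  fix l assume "fop N ((*\<^sub>v) K) f = fscale (q powi m) f"
  then have "K *\<^sub>v v = q powi m \<cdot>\<^sub>v v"
    using v K fvec_eq_iff[of "K *\<^sub>v v" N "q powi m \<cdot>\<^sub>v v"] by (simp add: fop_fvec fvec_smult)
  then show "fop N (eigenproj N P Pinv ex l) f = (if l = m then f else 0)"
    using v eigenproj_eigenvector[OF v(1)] by (simp add: fop_fvec fvec_zero)
qed (use q_nonzero q_not_root in auto)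

end

section \<open>Representations of the quantum loop algebra\<close>

locale quantum_loop_rep =
  fixes n :: nat and ahat :: "nat \<Rightarrow> nat \<Rightarrow> int" and d :: "nat \<Rightarrow> nat" and \<theta> :: "nat \<Rightarrow> int"
    and q :: "'k::field" and N :: nat and Em Fm Km Kinv :: "nat \<Rightarrow> 'k mat"
  assumes q_nonzero: "q \<noteq> 0" and q_not_root: "\<And>m::int. q powi m = 1 \<Longrightarrow> m = 0"
    and d_pos: "\<And>i. i \<le> n \<Longrightarrow> d i > 0" and \<theta>_pos: "\<And>i. i \<in> {1..n} \<Longrightarrow> \<theta> i > 0"
    and ahat_diag: "\<And>i. i \<le> n \<Longrightarrow> ahat i i = 2"
    and rep: "is_UqLg_rep n ahat d \<theta> q N Em Fm Km Kinv"
    and semisimple: "K_semisimple_qZ n q N Km"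
begin

lemma q_powi_eq_iff: "q powi a = q powi b \<longleftrightarrow> a = b"
  by (rule power_int_inj_iff[OF q_nonzero q_not_root])

lemma carrier:
  assumes "i \<le> n"
  shows "Em i \<in> carrier_mat N N" "Fm i \<in> carrier_mat N N" "Km i \<in> carrier_mat N N" "Kinv i \<in> carrier_mat N N"
  using rep assms unfolding is_UqLg_rep_def by auto

lemma K_Kinv:
  assumes "i \<le> n"
  shows "Km i * Kinv i = 1\<^sub>m N" "Kinv i * Km i = 1\<^sub>m N"
  using rep assms unfolding is_UqLg_rep_def by auto

lemma Kinv_K_vec:
  assumes "i \<le> n" "v \<in> carrier_vec N"
  shows "Kinv i *\<^sub>v (Km i *\<^sub>v v) = v"
  using assoc_mult_mat_vec[OF carrier(4,3)[OF assms(1)] assms(2)] K_Kinv[OF assms(1)] assms(2) by simp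

lemma K_K_vec:
  assumes "i \<le> n" "j \<le> n" "v \<in> carrier_vec N"
  shows "Km i *\<^sub>v (Km j *\<^sub>v v) = Km j *\<^sub>v (Km i *\<^sub>v v)"
proof -
  have "Km i * Km j = Km j * Km i"
    using rep assms unfolding is_UqLg_rep_def by auto
  then show ?thesis
    using assoc_mult_mat_vec[OF carrier(3)[OF assms(1)] carrier(3)[OF assms(2)] assms(3)]
      assoc_mult_mat_vec[OF carrier(3)[OF assms(2)] carrier(3)[OF assms(1)] assms(3)] by simp
qed

text \<open>K X v = (K X K^(-1)) K v turns the conjugation relation into a shift of exponents. It
  covers both E_j and F_j, with opposite signs of \<open>c\<close>.\<close>

lemma weight_shift:
  assumes i: "i \<le> n" and X: "X \<in> carrier_mat N N"
    and conj: "Km i * X * Kinv i = ((q ^ d i) powi c) \<cdot>\<^sub>m X"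
    and v: "v \<in> carrier_vec N" "Km i *\<^sub>v v = q powi m \<cdot>\<^sub>v v"
  shows "Km i *\<^sub>v (X *\<^sub>v v) = q powi (m + int (d i) * c) \<cdot>\<^sub>v (X *\<^sub>v v)"
proof -
  note K = carrier(3)[OF i] and Ki = carrier(4)[OF i]
  have "Km i *\<^sub>v (X *\<^sub>v v) = (Km i * X) *\<^sub>v (Kinv i *\<^sub>v (Km i *\<^sub>v v))"
    using assoc_mult_mat_vec[OF K X v(1)] Kinv_K_vec[OF i v(1)] by simp
  also have "\<dots> = (Km i * X * Kinv i) *\<^sub>v (Km i *\<^sub>v v)"
    using K X Ki v(1) by (intro assoc_mult_mat_vec[symmetric, of _ N N _ N]) auto
  also have "\<dots> = q powi (int (d i) * c) \<cdot>\<^sub>v (X *\<^sub>v (q powi m \<cdot>\<^sub>v v))"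
    using X v by (intro eq_vecI) (auto simp: conj power_int_power)
  also have "\<dots> = q powi (m + int (d i) * c) \<cdot>\<^sub>v (X *\<^sub>v v)"
    using q_nonzero by (simp add: mult_mat_vec[OF X v(1)] smult_smult_assoc power_int_add mult.commute)
  finally show ?thesis .
qed

lemma E_weight:
  assumes "i \<le> n" "j \<le> n" "v \<in> carrier_vec N" "Km i *\<^sub>v v = q powi m \<cdot>\<^sub>v v"
  shows "Km i *\<^sub>v (Em j *\<^sub>v v) = q powi (m + int (d i) * ahat i j) \<cdot>\<^sub>v (Em j *\<^sub>v v)"
  by (rule weight_shift[OF assms(1) carrier(1)[OF assms(2)] _ assms(3,4)])
    (use rep assms in \<open>auto simp: is_UqLg_rep_def\<close>)

lemma F_weight:
  assumes "i \<le> n" "j \<le> n" "v \<in> carrier_vec N" "Km i *\<^sub>v v = q powi m \<cdot>\<^sub>v v"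
  shows "Km i *\<^sub>v (Fm j *\<^sub>v v) = q powi (m - int (d i) * ahat i j) \<cdot>\<^sub>v (Fm j *\<^sub>v v)"
proof -
  have "Km i *\<^sub>v (Fm j *\<^sub>v v) = q powi (m + int (d i) * (- ahat i j)) \<cdot>\<^sub>v (Fm j *\<^sub>v v)"
    by (rule weight_shift[OF assms(1) carrier(2)[OF assms(2)] _ assms(3,4)])
      (use rep assms in \<open>auto simp: is_UqLg_rep_def\<close>)
  then show ?thesis by simp
qed

definition \<kappa> :: "nat \<Rightarrow> 'k" where
  "\<kappa> i = inverse (q ^ d i - inverse (q ^ d i))"

lemma \<kappa>_nonzero:
  assumes "i \<le> n"
  shows "\<kappa> i \<noteq> 0"
proof -
  have "q powi int (d i) \<noteq> q powi (- int (d i))"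
    using d_pos[OF assms] by (simp add: q_powi_eq_iff del: power_int_of_nat)
  then show ?thesis by (simp add: \<kappa>_def power_int_minus)
qed

text \<open>On an eigenvector of K_i with eigenvalue q^m, the inverse acts by q^(-m), so the
  commutator relation becomes scalar.\<close>

lemma E_F_vec:
  assumes i: "i \<le> n" and v: "v \<in> carrier_vec N" "Km i *\<^sub>v v = q powi m \<cdot>\<^sub>v v"
  shows "Em i *\<^sub>v (Fm i *\<^sub>v v) = Fm i *\<^sub>v (Em i *\<^sub>v v) + (\<kappa> i * (q powi m - q powi (- m))) \<cdot>\<^sub>v v"
proof -
  note E = carrier(1)[OF i] and F = carrier(2)[OF i] and K = carrier(3)[OF i] and Ki = carrier(4)[OF i]
  have "v = q powi m \<cdot>\<^sub>v (Kinv i *\<^sub>v v)"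
    using Kinv_K_vec[OF i v(1)] by (simp add: v(2) mult_mat_vec[OF Ki v(1)])
  then have "q powi (- m) \<cdot>\<^sub>v v = q powi (- m) \<cdot>\<^sub>v (q powi m \<cdot>\<^sub>v (Kinv i *\<^sub>v v))"
    by simp
  then have Kiv: "Kinv i *\<^sub>v v = q powi (- m) \<cdot>\<^sub>v v"
    using q_nonzero by (simp add: smult_smult_assoc power_int_minus)
  have comm: "Em i * Fm i - Fm i * Em i = \<kappa> i \<cdot>\<^sub>m (Km i - Kinv i)"
    using rep i unfolding is_UqLg_rep_def \<kappa>_def by auto
  have "Em i *\<^sub>v (Fm i *\<^sub>v v) - Fm i *\<^sub>v (Em i *\<^sub>v v) = (Em i * Fm i - Fm i * Em i) *\<^sub>v v"
    using E F v(1) by (simp add: minus_mult_distrib_mat_vec[of _ N N] assoc_mult_mat_vec[of _ N N _ N])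
  also have "\<dots> = \<kappa> i \<cdot>\<^sub>v (Km i *\<^sub>v v - Kinv i *\<^sub>v v)"
    using K Ki v(1) unfolding comm
    by (subst minus_mult_distrib_mat_vec[of _ N N, symmetric]) (auto intro!: eq_vecI)
  also have "\<dots> = (\<kappa> i * (q powi m - q powi (- m))) \<cdot>\<^sub>v v"
    using v(1) by (intro eq_vecI) (auto simp: v(2) Kiv algebra_simps)
  finally have eq: "Em i *\<^sub>v (Fm i *\<^sub>v v) - Fm i *\<^sub>v (Em i *\<^sub>v v) = (\<kappa> i * (q powi m - q powi (- m))) \<cdot>\<^sub>v v" .
  show ?thesis
    unfolding eq[symmetric] using E F v(1) by (intro eq_vecI) auto
qed

lemma kac_label_pos: "i \<le> n \<Longrightarrow> kac_label \<theta> i > 0"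
  using \<theta>_pos by (auto simp: kac_label_def)

lemma K_power_vec:
  assumes "i \<le> n" "v \<in> carrier_vec N" "Km i *\<^sub>v v = q powi m \<cdot>\<^sub>v v"
  shows "(Km i ^\<^sub>m k) *\<^sub>v v = q powi (int k * m) \<cdot>\<^sub>v v"
proof (induction k)
  case 0
  show ?case using carrier(3)[OF assms(1)] assms(2) by simp
next
  case (Suc k)
  note K = carrier(3)[OF assms(1)]
  have "(Km i ^\<^sub>m Suc k) *\<^sub>v v = (Km i ^\<^sub>m k) *\<^sub>v (q powi m \<cdot>\<^sub>v v)"
    using assoc_mult_mat_vec[OF pow_carrier_mat[OF K] K assms(2)] assms(3) by simp
  also have "\<dots> = q powi m \<cdot>\<^sub>v (q powi (int k * m) \<cdot>\<^sub>v v)"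
    using mult_mat_vec[OF pow_carrier_mat[OF K] assms(2)] Suc.IH by simp
  finally show ?case
    using q_nonzero by (simp add: smult_smult_assoc power_int_add distrib_right)
qed

text \<open>On a joint eigenvector the product of the K_i^(a_i) is \<open>q\<close> to the weighted
  sum of exponents. As the product is 1 and \<open>q\<close> is not a root of unity, that sum is
  zero.\<close>

lemma level_zero_vec:
  assumes v: "v \<in> carrier_vec N" "v \<noteq> 0\<^sub>v N" and \<mu>: "\<And>i. i \<le> n \<Longrightarrow> Km i *\<^sub>v v = q powi \<mu> i \<cdot>\<^sub>v v"
  shows "(\<Sum>i\<le>n. kac_label \<theta> i * \<mu> i) = 0"
proof -
  let ?f = "\<lambda>i. Km i ^\<^sub>m nat (kac_label \<theta> i)"
  have f: "?f i \<in> carrier_mat N N" if "i \<le> n" for i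
    using carrier(3)[OF that] by simp
  \<comment> \<open>The product is evaluated for arbitrary index lists, to allow induction along its
    recursive definition.\<close>
  have "mprod N ?f xs \<in> carrier_mat N N \<and>
      mprod N ?f xs *\<^sub>v v = q powi (\<Sum>i\<leftarrow>xs. kac_label \<theta> i * \<mu> i) \<cdot>\<^sub>v v" if "set xs \<subseteq> {..n}" for xs
    using that
  proof (induction xs)
    case Nil
    then show ?case using v by (simp add: mprod_def)
  next
    case (Cons i xs)
    then have i: "i \<le> n" and IH: "mprod N ?f xs \<in> carrier_mat N N"
        "mprod N ?f xs *\<^sub>v v = q powi (\<Sum>i\<leftarrow>xs. kac_label \<theta> i * \<mu> i) \<cdot>\<^sub>v v" by auto
    have "mprod N ?f (i # xs) *\<^sub>v v = ?f i *\<^sub>v (mprod N ?f xs *\<^sub>v v)"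
      using assoc_mult_mat_vec[OF f[OF i] IH(1) v(1)] by (simp add: mprod_def)
    also have "\<dots> = q powi (\<Sum>i\<leftarrow>xs. kac_label \<theta> i * \<mu> i) \<cdot>\<^sub>v (q powi (kac_label \<theta> i * \<mu> i) \<cdot>\<^sub>v v)"
      using kac_label_pos[OF i] by (simp add: IH(2) mult_mat_vec[OF f[OF i] v(1)] K_power_vec[OF i v(1) \<mu>[OF i]])
    finally show ?case
      using f[OF i] IH(1) q_nonzero by (simp add: mprod_def smult_smult_assoc power_int_add mult.commute)
  qed
  moreover have "set [0..<Suc n] \<subseteq> {..n}" by auto
  ultimately have "mprod N ?f [0..<Suc n] *\<^sub>v v = q powi (\<Sum>i\<leftarrow>[0..<Suc n]. kac_label \<theta> i * \<mu> i) \<cdot>\<^sub>v v"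
    by blast
  moreover have "mprod N ?f [0..<Suc n] = 1\<^sub>m N"
    using rep unfolding is_UqLg_rep_def by blast
  moreover have "(\<Sum>i\<leftarrow>[0..<Suc n]. kac_label \<theta> i * \<mu> i) = (\<Sum>i\<le>n. kac_label \<theta> i * \<mu> i)"
    by (simp only: interv_sum_list_conv_sum_set_nat atLeast0LessThan[symmetric] lessThan_Suc_atMost[symmetric] set_upt)
  ultimately have eq: "v = q powi (\<Sum>i\<le>n. kac_label \<theta> i * \<mu> i) \<cdot>\<^sub>v v"
    using v(1) by simp
  \<comment> \<open>A nonzero entry of \<open>v\<close> allows the scalar to be read off.\<close>
  obtain a where a: "a < N" "v $ a \<noteq> 0"
    using v by (metis eq_vecI carrier_vecD index_zero_vec)
  have "(q powi (\<Sum>i\<le>n. kac_label \<theta> i * \<mu> i) \<cdot>\<^sub>v v) $ a = v $ a"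
    by (simp only: eq[symmetric])
  then have "q powi (\<Sum>i\<le>n. kac_label \<theta> i * \<mu> i) = 1"
    using a v(1) by simp
  then show ?thesis by (rule q_not_root)
qed

lemma diagonalisation:
  assumes "i \<le> n"
  shows "\<exists>P Pinv D ex. diagonalised N q (Km i) P Pinv D ex"
proof -
  obtain P Pinv D where *: "P \<in> carrier_mat N N" "Pinv \<in> carrier_mat N N" "D \<in> carrier_mat N N"
      "P * Pinv = 1\<^sub>m N" "Pinv * P = 1\<^sub>m N" "\<forall>a<N. \<forall>b<N. a \<noteq> b \<longrightarrow> D $$ (a, b) = 0"
      "\<forall>a<N. \<exists>m::int. D $$ (a, a) = q powi m" "Km i = P * D * Pinv"
    using semisimple assms unfolding K_semisimple_qZ_def by (metis atLeastAtMost_iff zero_le)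
  obtain ex where "\<And>a. a < N \<Longrightarrow> D $$ (a, a) = q powi ex a"
    using *(7) by metis
  then have "diagonalised N q (Km i) P Pinv D ex"
    using * q_nonzero q_not_root by unfold_locales auto
  then show ?thesis by blast
qed

text \<open>The projections and exponent sets come from a diagonalisation chosen for each K_i
  separately, hence the existential statement.\<close>

lemma affine_rep_fop:
  "\<exists>Pr M. affine_rep fscale (fspace N) q n (\<lambda>i. int (d i)) (\<lambda>i j. int (d i) * ahat i j) (kac_label \<theta>) \<kappa>
     (\<lambda>i. fop N ((*\<^sub>v) (Em i))) (\<lambda>i. fop N ((*\<^sub>v) (Fm i))) (\<lambda>i. fop N ((*\<^sub>v) (Km i))) Pr M"
proof -
  obtain P Pinv D ex where diag: "\<And>i. i \<le> n \<Longrightarrow> diagonalised N q (Km i) (P i) (Pinv i) (D i) (ex i)"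
    using diagonalisation by metis
  let ?Pr = "\<lambda>i m. fop N (eigenproj N (P i) (Pinv i) (ex i) m)" and ?M = "\<lambda>i. ex i ` {..<N}"
  have eigen: "fop N ((*\<^sub>v) (Km i)) (fvec v) = fscale (q powi m) (fvec v) \<longleftrightarrow> Km i *\<^sub>v v = q powi m \<cdot>\<^sub>v v"
    if "i \<le> n" "v \<in> carrier_vec N" for i m v
    using that carrier(3)[OF that(1)] fvec_eq_iff[of "Km i *\<^sub>v v" N "q powi m \<cdot>\<^sub>v v"]
    by (simp add: fop_fvec fvec_smult mult_mat_vec_carrier[of _ N N])
  have stable: "fop N ((*\<^sub>v) X) f \<in> fspace N" if "X \<in> carrier_mat N N" "f \<in> fspace N" for X f
    using that by (metis fop_fvec fspace_cases fvec_fspace mult_mat_vec_carrier)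
  have "affine_rep fscale (fspace N) q n (\<lambda>i. int (d i)) (\<lambda>i j. int (d i) * ahat i j) (kac_label \<theta>) \<kappa>
     (\<lambda>i. fop N ((*\<^sub>v) (Em i))) (\<lambda>i. fop N ((*\<^sub>v) (Fm i))) (\<lambda>i. fop N ((*\<^sub>v) (Km i))) ?Pr ?M"
  proof (intro affine_rep.intro affine_rep_axioms.intro)
    show "vector_space (fscale :: 'k \<Rightarrow> (nat \<Rightarrow> 'k) \<Rightarrow> nat \<Rightarrow> 'k)" by (rule fn.vector_space_axioms)
  next
    fix i assume i: "i \<le> n"
    note E = carrier(1)[OF i] and F = carrier(2)[OF i]
    interpret eigenspace_decomposition fscale "fspace N" q "fop N ((*\<^sub>v) (Km i))" "?Pr i" "?M i"
      by (rule diagonalised.eigenspace_decomposition_fop[OF diag[OF i]])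
    have wtD: "\<exists>v. v \<in> carrier_vec N \<and> f = fvec v \<and> Km i *\<^sub>v v = q powi m \<cdot>\<^sub>v v" if "f \<in> wt m" for f m
      using that eigen[OF i] by (auto simp: wt_def elim!: fspace_cases)
    have wtI: "fvec v \<in> wt m" if "v \<in> carrier_vec N" "Km i *\<^sub>v v = q powi m \<cdot>\<^sub>v v" for v m
      using that eigen[OF i] by (simp add: wt_def fvec_fspace)
    show "quantum_sl2 fscale (fspace N) q (fop N ((*\<^sub>v) (Km i))) (?Pr i) (?M i)
        (fop N ((*\<^sub>v) (Em i))) (fop N ((*\<^sub>v) (Fm i))) (int (d i)) (\<kappa> i)"
    proof (intro quantum_sl2.intro quantum_sl2_axioms.intro)
      show "eigenspace_decomposition fscale (fspace N) q (fop N ((*\<^sub>v) (Km i))) (?Pr i) (?M i)"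
        by (rule diagonalised.eigenspace_decomposition_fop[OF diag[OF i]])
      show "Vector_Spaces.linear fscale fscale (fop N ((*\<^sub>v) (Em i)))"
        by (rule linear_fop[OF linear_vec_mult_mat[OF E]])
      show "Vector_Spaces.linear fscale fscale (fop N ((*\<^sub>v) (Fm i)))"
        by (rule linear_fop[OF linear_vec_mult_mat[OF F]])
      show "int (d i) > 0" using d_pos[OF i] by simp
      show "\<kappa> i \<noteq> 0" by (rule \<kappa>_nonzero[OF i])
    next
      fix m f assume "f \<in> wt m"
      then obtain v where v: "v \<in> carrier_vec N" "f = fvec v" "Km i *\<^sub>v v = q powi m \<cdot>\<^sub>v v"
        using wtD by blast
      have Ev: "Em i *\<^sub>v v \<in> carrier_vec N" and Fv: "Fm i *\<^sub>v v \<in> carrier_vec N"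
        using E F v(1) by auto
      show "fop N ((*\<^sub>v) (Em i)) f \<in> wt (m + 2 * int (d i))"
        using wtI[OF Ev, of "m + 2 * int (d i)"] E_weight[OF i i v(1,3)] ahat_diag[OF i]
        by (simp add: v(2) fop_fvec[OF v(1)] mult.commute)
      show "fop N ((*\<^sub>v) (Fm i)) f \<in> wt (m - 2 * int (d i))"
        using wtI[OF Fv, of "m - 2 * int (d i)"] F_weight[OF i i v(1,3)] ahat_diag[OF i]
        by (simp add: v(2) fop_fvec[OF v(1)] mult.commute)
      have FEv: "Fm i *\<^sub>v (Em i *\<^sub>v v) \<in> carrier_vec N" using F Ev by simp
      show "fop N ((*\<^sub>v) (Em i)) (fop N ((*\<^sub>v) (Fm i)) f) = fop N ((*\<^sub>v) (Fm i)) (fop N ((*\<^sub>v) (Em i)) f) +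
          fscale (\<kappa> i * (q powi m - q powi - m)) f"
        using v(1)
        by (simp add: v(2) fop_fvec[OF v(1)] fop_fvec[OF Ev] fop_fvec[OF Fv] E_F_vec[OF i v(1,3)]
            fvec_add[OF FEv] fvec_smult)
    qed
  next
    show "\<exists>S. finite S \<and> (fspace N :: (nat \<Rightarrow> 'k) set) \<subseteq> fn.span S" by (rule fspace_finite)
  next
    fix i and f :: "nat \<Rightarrow> 'k" assume i: "i \<le> n" and f: "f \<in> fspace N"
    show "fop N ((*\<^sub>v) (Fm i)) f \<in> fspace N" by (rule stable[OF carrier(2)[OF i] f])
    show "fop N ((*\<^sub>v) (Km i)) f \<in> fspace N" by (rule stable[OF carrier(3)[OF i] f])
    fix j assume j: "j \<le> n"
    obtain v where v: "v \<in> carrier_vec N" "f = fvec v" using f by (rule fspace_cases)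
    have Kiv: "Km i *\<^sub>v v \<in> carrier_vec N" and Kjv: "Km j *\<^sub>v v \<in> carrier_vec N"
      and Fjv: "Fm j *\<^sub>v v \<in> carrier_vec N"
      using carrier(3)[OF i] carrier(3)[OF j] carrier(2)[OF j] v(1) by auto
    show "fop N ((*\<^sub>v) (Km i)) (fop N ((*\<^sub>v) (Km j)) f) = fop N ((*\<^sub>v) (Km j)) (fop N ((*\<^sub>v) (Km i)) f)"
      by (simp add: v(2) fop_fvec[OF v(1)] fop_fvec[OF Kiv] fop_fvec[OF Kjv] K_K_vec[OF i j v(1)])
    fix m assume "fop N ((*\<^sub>v) (Km i)) f = fscale (q powi m) f"
    then have "Km i *\<^sub>v v = q powi m \<cdot>\<^sub>v v" using eigen[OF i v(1)] v(2) by simp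
    then show "fop N ((*\<^sub>v) (Km i)) (fop N ((*\<^sub>v) (Fm j)) f) =
        fscale (q powi (m - int (d i) * ahat i j)) (fop N ((*\<^sub>v) (Fm j)) f)"
      unfolding v(2) fop_fvec[OF v(1)] using F_weight[OF i j v(1)] eigen[OF i Fjv] by blast
  next
    fix i assume "i \<le> n" then show "kac_label \<theta> i > 0" by (rule kac_label_pos)
  next
    fix f :: "nat \<Rightarrow> 'k" and \<mu> assume f: "f \<in> fspace N" "f \<noteq> 0"
      and eig: "\<And>i. i \<le> n \<Longrightarrow> fop N ((*\<^sub>v) (Km i)) f = fscale (q powi \<mu> i) f"
    obtain v where v: "v \<in> carrier_vec N" "f = fvec v" using f(1) by (rule fspace_cases)
    have "v \<noteq> 0\<^sub>v N" using f(2) v(2) fvec_zero by metis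
    then show "(\<Sum>i\<le>n. kac_label \<theta> i * \<mu> i) = 0"
      using level_zero_vec[OF v(1)] eigen[OF _ v(1)] eig unfolding v(2) by blast
  qed
  then show ?thesis by blast
qed

text \<open>\<open>A.F_irreducible\<close> is carried back from coordinate functions to vectors; a
  stable space \<open>U\<close> of functions corresponds to the space \<open>?W\<close> of vectors,
  to which irreducibility applies.\<close>

theorem F_irreducible_vec:
  assumes irr: "irreducible_action N (UqLg_gens n Em Fm Km Kinv)"
    and W: "is_subspace N W" and FW: "\<And>i w. i \<le> n \<Longrightarrow> w \<in> W \<Longrightarrow> Fm i *\<^sub>v w \<in> W"
  shows "W = {0\<^sub>v N} \<or> W = carrier_vec N"
proof -
  obtain Pr M where "affine_rep fscale (fspace N) q n (\<lambda>i. int (d i)) (\<lambda>i j. int (d i) * ahat i j) (kac_label \<theta>) \<kappa>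
     (\<lambda>i. fop N ((*\<^sub>v) (Em i))) (\<lambda>i. fop N ((*\<^sub>v) (Fm i))) (\<lambda>i. fop N ((*\<^sub>v) (Km i))) Pr M"
    using affine_rep_fop by blast
  then interpret A: affine_rep fscale "fspace N" q n "\<lambda>i. int (d i)" "\<lambda>i j. int (d i) * ahat i j" "kac_label \<theta>" \<kappa>
     "\<lambda>i. fop N ((*\<^sub>v) (Em i))" "\<lambda>i. fop N ((*\<^sub>v) (Fm i))" "\<lambda>i. fop N ((*\<^sub>v) (Km i))" Pr M .
  have WN: "W \<subseteq> carrier_vec N" using W by (simp add: is_subspace_def)
  have "fvec ` W = {0} \<or> fvec ` W = fspace N"
  proof (rule A.F_irreducible)
    show "fn.subspace (fvec ` W)" by (rule subspace_vec_fun[OF W])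
    show "fvec ` W \<subseteq> fspace N" using WN fvec_fspace by blast
    show "fop N ((*\<^sub>v) (Fm i)) f \<in> fvec ` W" if "i \<le> n" "f \<in> fvec ` W" for i f
      using that FW WN by (auto simp: fop_fvec subset_iff)
  next
    fix U :: "(nat \<Rightarrow> 'k) set"
    assume U: "fn.subspace U" "U \<subseteq> fspace N"
      and stable: "\<And>i u. i \<le> n \<Longrightarrow> u \<in> U \<Longrightarrow> fop N ((*\<^sub>v) (Em i)) u \<in> U \<and> fop N ((*\<^sub>v) (Fm i)) u \<in> U \<and>
        fop N ((*\<^sub>v) (Km i)) u \<in> U"
    let ?W = "{v \<in> carrier_vec N. fvec v \<in> U}"
    have sub: "is_subspace N ?W" by (rule subspace_fun_vec[OF U(1)])
    \<comment> \<open>The generators include K_i^(-1), whereas \<open>U\<close> is so far only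
      stable under E_i, F_i and K_i.\<close>
    have Ki: "fop N ((*\<^sub>v) (Kinv i)) u \<in> U" if i: "i \<le> n" and u: "u \<in> U" for i u
    proof -
      interpret Q: quantum_sl2 fscale "fspace N" q "fop N ((*\<^sub>v) (Km i))" "Pr i" "M i"
          "fop N ((*\<^sub>v) (Em i))" "fop N ((*\<^sub>v) (Fm i))" "int (d i)" "\<kappa> i"
        by (rule A.sl2[OF i])
      have inv: "fop N ((*\<^sub>v) (Kinv i)) (fop N ((*\<^sub>v) (Km i)) f) = f" if "f \<in> fspace N" for f
        using that carrier(3)[OF i] Kinv_K_vec[OF i] by (elim fspace_cases) (simp add: fop_fvec mult_mat_vec_carrier[of _ N N])
      show ?thesis
        by (rule Q.inverse_stable[OF linear_fop[OF linear_vec_mult_mat[OF carrier(4)[OF i]]] inv U _ u])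
          (use stable i in auto)
    qed
    have "X *\<^sub>v v \<in> ?W" if "X \<in> UqLg_gens n Em Fm Km Kinv" "v \<in> ?W" for X v
    proof -
      obtain i where i: "i \<le> n" "X \<in> {Em i, Fm i, Km i, Kinv i}"
        using \<open>X \<in> UqLg_gens n Em Fm Km Kinv\<close> by (auto simp: UqLg_gens_def)
      then have X: "X \<in> carrier_mat N N" using carrier[OF i(1)] by auto
      have "fop N ((*\<^sub>v) X) (fvec v) \<in> U"
        using i stable[OF i(1), of "fvec v"] Ki[OF i(1), of "fvec v"] that by auto
      then show ?thesis using X that by (simp add: fop_fvec mult_mat_vec_carrier[of _ N N])
    qed
    moreover have "UqLg_gens n Em Fm Km Kinv \<subseteq> carrier_mat N N"
      using carrier by (auto simp: UqLg_gens_def)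
    ultimately have "\<forall>X\<in>gen_alg N (UqLg_gens n Em Fm Km Kinv). \<forall>v\<in>?W. X *\<^sub>v v \<in> ?W"
      using gen_alg_stable[OF _ _ sub] by blast
    then have "?W = {0\<^sub>v N} \<or> ?W = carrier_vec N"
      using irr sub unfolding irreducible_action_def by blast
    moreover have U_eq: "U = fvec ` ?W"
      using U(2) by (auto elim!: fspace_cases)
    ultimately have "U = fvec ` {0\<^sub>v N} \<or> U = fvec ` carrier_vec N"
      using trans[OF U_eq arg_cong[of _ _ "(`) fvec"]] by blast
    moreover have "fvec ` carrier_vec N = (fspace N :: (nat \<Rightarrow> 'k) set)"
      by (auto intro: fvec_fspace elim!: fspace_cases)
    ultimately show "U = {0} \<or> U = fspace N"
      by (simp add: fvec_zero)
  qed
  then show ?thesis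
  proof
    assume "fvec ` W = {0}"
    then have "w = 0\<^sub>v N" if "w \<in> W" for w
      using that WN fvec_eq_iff[of w N "0\<^sub>v N"] by (auto simp: fvec_zero)
    then show ?thesis using W by (auto simp: is_subspace_def)
  next
    assume full: "fvec ` W = fspace N"
    have "v \<in> W" if v: "v \<in> carrier_vec N" for v
    proof -
      obtain w where "w \<in> W" "fvec v = fvec w" using full fvec_fspace[OF v] by blast
      then show ?thesis using v WN fvec_eq_iff[of v N w] by auto
    qed
    then show ?thesis using WN by blast
  qed
qed

end


section \<open>Specialisation at \<open>z = 0\<close>\<close>

lemma const_Fz_to_fract: "const_Fz = (\<lambda>c. to_fract [:c:])"
  by (simp add: fun_eq_iff const_Fz_def to_fract_def)

lemma var_z_to_fract: "var_z = to_fract [:0, 1:]"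
  by (simp add: var_z_def to_fract_def)

lemma var_z_nonzero: "(var_z :: 'k::field poly fract) \<noteq> 0"
  by (simp add: var_z_to_fract)

lemma is_subspaceD:
  assumes "is_subspace N W"
  shows "W \<subseteq> carrier_vec N" "0\<^sub>v N \<in> W" "\<And>v w. v \<in> W \<Longrightarrow> w \<in> W \<Longrightarrow> v + w \<in> W"
    "\<And>c v. v \<in> W \<Longrightarrow> c \<cdot>\<^sub>v v \<in> W"
  using assms by (auto simp: is_subspace_def)

text \<open>The specialisation at \<open>z = 0\<close> of the lattice of polynomial vectors in \<open>W\<close>.\<close>
definition at_zero :: "nat \<Rightarrow> 'k::field poly fract vec set \<Rightarrow> 'k vec set" where
  "at_zero N W = {map_vec (\<lambda>p. poly p 0) P |P. P \<in> carrier_vec N \<and> map_vec to_fract P \<in> W}"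

lemma at_zero_carrier: "at_zero N W \<subseteq> carrier_vec N"
  by (auto simp: at_zero_def)

lemma at_zeroI:
  assumes "P \<in> carrier_vec N" "map_vec to_fract P \<in> W"
  shows "map_vec (\<lambda>p. poly p 0) P \<in> at_zero N W"
  using assms unfolding at_zero_def by blast

lemma at_zero_subspace:
  assumes W: "is_subspace N W"
  shows "is_subspace N (at_zero N W)"
  unfolding is_subspace_def
proof (intro conjI ballI allI)
  show "at_zero N W \<subseteq> carrier_vec N" by (rule at_zero_carrier)
  show "0\<^sub>v N \<in> at_zero N W"
    unfolding at_zero_def
  proof (intro CollectI exI conjI)
    show "0\<^sub>v N = map_vec (\<lambda>p. poly p 0) (0\<^sub>v N :: 'a poly vec)" by auto
    have "map_vec to_fract (0\<^sub>v N :: 'a poly vec) = 0\<^sub>v N" by auto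
    then show "map_vec to_fract (0\<^sub>v N :: 'a poly vec) \<in> W" using is_subspaceD(2)[OF W] by simp
  qed auto
next
  fix v w assume "v \<in> at_zero N W" "w \<in> at_zero N W"
  then obtain P Q where P: "P \<in> carrier_vec N" "map_vec to_fract P \<in> W" "v = map_vec (\<lambda>p. poly p 0) P"
    and Q: "Q \<in> carrier_vec N" "map_vec to_fract Q \<in> W" "w = map_vec (\<lambda>p. poly p 0) Q"
    by (auto simp: at_zero_def)
  have "map_vec to_fract (P + Q) = map_vec to_fract P + map_vec to_fract Q"
    using P Q by (intro eq_vecI) auto
  then have "map_vec to_fract (P + Q) \<in> W"
    using P Q is_subspaceD(3)[OF W] by simp
  moreover have "v + w = map_vec (\<lambda>p. poly p 0) (P + Q)"
    unfolding P Q using P Q by (intro eq_vecI) auto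
  ultimately show "v + w \<in> at_zero N W"
    using at_zeroI[of "P + Q"] P(1) Q(1) by simp
next
  fix c v assume "v \<in> at_zero N W"
  then obtain P where P: "P \<in> carrier_vec N" "map_vec to_fract P \<in> W" "v = map_vec (\<lambda>p. poly p 0) P"
    by (auto simp: at_zero_def)
  have "map_vec to_fract ([:c:] \<cdot>\<^sub>v P) = to_fract [:c:] \<cdot>\<^sub>v map_vec to_fract P"
    by (intro eq_vecI) (simp_all only: index_map_vec index_smult_vec to_fract_mult)
  then have "map_vec to_fract ([:c:] \<cdot>\<^sub>v P) \<in> W"
    using P is_subspaceD(4)[OF W] by simp
  moreover have "c \<cdot>\<^sub>v v = map_vec (\<lambda>p. poly p 0) ([:c:] \<cdot>\<^sub>v P)"
    unfolding P using P by (intro eq_vecI) auto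
  moreover have "[:c:] \<cdot>\<^sub>v P \<in> carrier_vec N" using P by simp
  ultimately show "c \<cdot>\<^sub>v v \<in> at_zero N W"
    using at_zeroI[of "[:c:] \<cdot>\<^sub>v P"] by simp
qed

text \<open>\<open>D\<close> is the product of denominators of all entries, and each entry of
  \<open>P\<close> is a numerator times the other denominators.\<close>

lemma polynomial_multiple:
  fixes w :: "'k::field poly fract vec"
  obtains D P where "D \<noteq> 0" "P \<in> carrier_vec (dim_vec w)" "map_vec to_fract P = to_fract D \<cdot>\<^sub>v w"
proof -
  have "\<exists>p r. r \<noteq> 0 \<and> x = to_fract p / to_fract r" for x :: "'k poly fract"
    by (cases x) (auto simp: Fract_conv_to_fract)
  then obtain num den where nd: "\<And>x :: 'k poly fract. den x \<noteq> 0 \<and> x = to_fract (num x) / to_fract (den x)"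
    by metis
  define D where "D = (\<Prod>a<dim_vec w. den (w $ a))"
  define P where "P = vec (dim_vec w) (\<lambda>a. num (w $ a) * (\<Prod>b\<in>{..<dim_vec w} - {a}. den (w $ b)))"
  have "to_fract D * w $ a = to_fract (P $ a)" if a: "a < dim_vec w" for a
  proof -
    have "to_fract D = to_fract (den (w $ a)) * to_fract (\<Prod>b\<in>{..<dim_vec w} - {a}. den (w $ b))"
      unfolding D_def using a by (subst prod.remove[of _ a]) auto
    moreover have "to_fract (den (w $ a)) * w $ a = to_fract (num (w $ a))"
      using nd[of "w $ a"] by (metis nonzero_mult_div_cancel_left times_divide_eq_right to_fract_eq_0_iff)
    ultimately show ?thesis
      using a by (simp add: P_def mult.commute mult.left_commute)
  qed
  then have "map_vec to_fract P = to_fract D \<cdot>\<^sub>v w"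
    by (intro eq_vecI) (auto simp: P_def)
  moreover have "D \<noteq> 0" using nd by (auto simp: D_def)
  ultimately show ?thesis using that[of D P] by (auto simp: P_def)
qed

text \<open>Clearing denominators gives a nonzero polynomial vector in \<open>W\<close>. While its
  value at 0 is zero, it can be divided by z inside \<open>W\<close>; the total degree drops, so
  this ends with a nonzero value.\<close>

lemma at_zero_nonzero:
  fixes W :: "'k::field poly fract vec set"
  assumes W: "is_subspace N W" and "W \<noteq> {0\<^sub>v N}"
  shows "at_zero N W \<noteq> {0\<^sub>v N}"
proof -
  obtain w where w: "w \<in> W" "w \<noteq> 0\<^sub>v N"
    using assms is_subspaceD(2)[OF W] by blast
  have wN: "w \<in> carrier_vec N" using w is_subspaceD(1)[OF W] by blast
  have descent: "at_zero N W \<noteq> {0\<^sub>v N}"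
    if "P \<in> carrier_vec N" "map_vec to_fract P \<in> W" "P \<noteq> 0\<^sub>v N" for P
    using that
  proof (induction "\<Sum>a<N. degree (P $ a)" arbitrary: P rule: less_induct)
    case less
    show ?case
    proof (cases "map_vec (\<lambda>p. poly p 0) P = 0\<^sub>v N")
      case False
      then show ?thesis using less.prems by (auto simp: at_zero_def)
    next
      case True
      have root: "poly (P $ a) 0 = 0" if "a < N" for a
        using arg_cong[OF True, of "\<lambda>v. v $ a"] that less.prems(1) by simp
      define Q where "Q = vec N (\<lambda>a. P $ a div [:0, 1:])"
      have PQ: "P $ a = [:0, 1:] * Q $ a" if "a < N" for a
        using root[OF that] that by (simp add: Q_def poly_eq_0_iff_dvd del: mult_pCons_left)
      have deg: "degree (P $ a) = (if P $ a = 0 then 0 else Suc (degree (Q $ a)))" if "a < N" for a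
        using PQ[OF that] by simp
      have "map_vec to_fract Q = inverse (to_fract [:0, 1:]) \<cdot>\<^sub>v map_vec to_fract P"
      proof (rule eq_vecI)
        fix a assume "a < dim_vec (inverse (to_fract [:0, 1:]) \<cdot>\<^sub>v map_vec to_fract P)"
        then have a: "a < N" "a < dim_vec P" using less.prems(1) by auto
        have "to_fract (P $ a) = to_fract [:0, 1:] * to_fract (Q $ a)"
          unfolding PQ[OF a(1)] by (rule to_fract_mult)
        then show "map_vec to_fract Q $ a = (inverse (to_fract [:0, 1:]) \<cdot>\<^sub>v map_vec to_fract P) $ a"
          using a by (simp add: Q_def)
      qed (use less.prems(1) in \<open>simp add: Q_def\<close>)
      then have "map_vec to_fract Q \<in> W"
        using less.prems(2) is_subspaceD(4)[OF W] by simp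
      moreover obtain a where a: "a < N" "P $ a \<noteq> 0"
        using less.prems(1,3) by (metis eq_vecI carrier_vecD index_zero_vec)
      have "Q \<noteq> 0\<^sub>v N"
        using PQ[OF a(1)] a by auto
      \<comment> \<open>Zero entries keep degree 0; the strict drop comes from the nonzero entry
        \<open>a\<close>.\<close>
      moreover have "(\<Sum>a<N. degree (Q $ a)) < (\<Sum>a<N. degree (P $ a))"
      proof (rule sum_strict_mono_ex1)
        show "\<forall>a\<in>{..<N}. degree (Q $ a) \<le> degree (P $ a)"
          using deg PQ by auto
        show "\<exists>a\<in>{..<N}. degree (Q $ a) < degree (P $ a)"
          using a deg by (intro bexI[of _ a]) auto
      qed simp
      ultimately show ?thesis
        using less.hyps[of Q] by (simp add: Q_def)
    qed
  qed
  obtain D P where D: "D \<noteq> 0" "P \<in> carrier_vec N" "map_vec to_fract P = to_fract D \<cdot>\<^sub>v w"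
    using polynomial_multiple[of w] wN by auto
  have "P \<noteq> 0\<^sub>v N"
  proof
    assume "P = 0\<^sub>v N"
    have "w $ a = 0" if "a < N" for a
      using arg_cong[OF D(3), of "\<lambda>v. v $ a"] that D(1,2) wN \<open>P = 0\<^sub>v N\<close> by simp
    then show False using w(2) wN by (metis eq_vecI carrier_vecD index_zero_vec)
  qed
  then show ?thesis
    using descent[of P] D is_subspaceD(4)[OF W w(1)] by simp
qed

lemma mult_mat_vec_in_subspace:
  assumes W: "is_subspace N W" and A: "A \<in> carrier_mat N N" "\<And>j. j < N \<Longrightarrow> col A j \<in> W"
    and x: "x \<in> carrier_vec N"
  shows "A *\<^sub>v x \<in> W"
proof -
  define S where "S k = vec N (\<lambda>i. \<Sum>j<k. A $$ (i, j) * x $ j)" for k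
  have "S k \<in> W" if "k \<le> N" for k
    using that
  proof (induction k)
    case 0
    have "S 0 = 0\<^sub>v N" by (auto simp: S_def)
    then show ?case using is_subspaceD(2)[OF W] by simp
  next
    case (Suc k)
    have "S (Suc k) = S k + x $ k \<cdot>\<^sub>v col A k"
      using A(1) Suc.prems by (intro eq_vecI) (auto simp: S_def mult.commute)
    then show ?case
      using Suc A(2) is_subspaceD(3,4)[OF W] by simp
  qed
  moreover have "A *\<^sub>v x = S N"
    using A(1) x by (intro eq_vecI) (auto simp: S_def scalar_prod_def lessThan_atLeast0)
  ultimately show ?thesis by simp
qed

text \<open>Unit vectors are lifted to polynomial vectors in \<open>W\<close>. The matrix with these
  columns is the identity at z = 0, so its determinant is a nonzero polynomial and its columns span
  over the fraction field.\<close>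

lemma at_zero_eq_carrier:
  fixes W :: "'k::field poly fract vec set"
  assumes W: "is_subspace N W" and full: "at_zero N W = carrier_vec N"
  shows "W = carrier_vec N"
proof -
  have "\<forall>a<N. \<exists>P. P \<in> carrier_vec N \<and> map_vec to_fract P \<in> W \<and> map_vec (\<lambda>p. poly p 0) P = unit_vec N a"
    using full unfolding at_zero_def by (smt (verit, best) mem_Collect_eq unit_vec_carrier)
  then obtain P where P: "\<And>a. a < N \<Longrightarrow> P a \<in> carrier_vec N" "\<And>a. a < N \<Longrightarrow> map_vec to_fract (P a) \<in> W"
      "\<And>a. a < N \<Longrightarrow> map_vec (\<lambda>p. poly p 0) (P a) = unit_vec N a"
    by metis
  define A where "A = mat N N (\<lambda>(i, j). P j $ i)"
  have A: "A \<in> carrier_mat N N" by (simp add: A_def)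
  interpret ev: comm_ring_hom "\<lambda>p :: 'k poly. poly p 0" by unfold_locales auto
  interpret fr: comm_ring_hom "to_fract :: 'k poly \<Rightarrow> 'k poly fract" by unfold_locales auto
  have "map_mat (\<lambda>p. poly p 0) A = 1\<^sub>m N"
  proof (rule eq_matI)
    fix i j assume ij: "i < dim_row (1\<^sub>m N)" "j < dim_col (1\<^sub>m N)"
    then show "map_mat (\<lambda>p. poly p 0) A $$ (i, j) = 1\<^sub>m N $$ (i, j)"
      using arg_cong[OF P(3)[of j], of "\<lambda>v. v $ i"] P(1)[of j] by (auto simp: A_def)
  qed (auto simp: A_def)
  then have "poly (det A) 0 = 1"
    using ev.hom_det[of A] by simp
  then have "det A \<noteq> 0" by auto
  define B where "B = map_mat to_fract A"
  have B: "B \<in> carrier_mat N N" using A by (simp add: B_def)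
  have detB: "det B \<noteq> 0"
    using \<open>det A \<noteq> 0\<close> by (simp add: B_def fr.hom_det)
  have colB: "col B j \<in> W" if "j < N" for j
  proof -
    have "col B j = map_vec to_fract (P j)"
      using that P(1)[OF that] by (intro eq_vecI) (auto simp: B_def A_def)
    then show ?thesis using P(2)[OF that] by simp
  qed
  have "v \<in> W" if v: "v \<in> carrier_vec N" for v
  proof -
    \<comment> \<open>\<open>?x\<close> is the inverse of \<open>B\<close> applied to
      \<open>v\<close>, written with the adjugate; it gives the coefficients of \<open>v\<close> in
      the columns of \<open>B\<close>.\<close>
    let ?x = "adj_mat B *\<^sub>v (inverse (det B) \<cdot>\<^sub>v v)"
    have "B *\<^sub>v ?x = (B * adj_mat B) *\<^sub>v (inverse (det B) \<cdot>\<^sub>v v)"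
      using B v adj_mat(1)[OF B] by (simp add: assoc_mult_mat_vec[of _ N N _ N])
    also have "\<dots> = v"
      using adj_mat(2)[OF B] detB v by (intro eq_vecI) auto
    finally show ?thesis
      using mult_mat_vec_in_subspace[OF W B colB, of ?x] v adj_mat(1)[OF B] by simp
  qed
  then show ?thesis using is_subspaceD(1)[OF W] by blast
qed

text \<open>A polynomial matrix preserves polynomial vectors, and its action commutes with
  evaluation at 0.\<close>

lemma at_zero_stable:
  fixes W :: "'k::field poly fract vec set"
  assumes G: "G \<in> carrier_mat N N" and GW: "\<And>w. w \<in> W \<Longrightarrow> map_mat to_fract G *\<^sub>v w \<in> W"
    and v: "v \<in> at_zero N W"
  shows "map_mat (\<lambda>p. poly p 0) G *\<^sub>v v \<in> at_zero N W"
proof -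
  interpret ev: comm_ring_hom "\<lambda>p :: 'k poly. poly p 0" by unfold_locales auto
  interpret fr: comm_ring_hom "to_fract :: 'k poly \<Rightarrow> 'k poly fract" by unfold_locales auto
  obtain P where P: "P \<in> carrier_vec N" "map_vec to_fract P \<in> W" "v = map_vec (\<lambda>p. poly p 0) P"
    using v by (auto simp: at_zero_def)
  have "map_vec to_fract (G *\<^sub>v P) \<in> W"
    using GW[OF P(2)] by (simp add: fr.mult_mat_vec_hom[OF G P(1)])
  moreover have "map_mat (\<lambda>p. poly p 0) G *\<^sub>v v = map_vec (\<lambda>p. poly p 0) (G *\<^sub>v P)"
    by (simp add: P(3) ev.mult_mat_vec_hom[OF G P(1)])
  moreover have "G *\<^sub>v P \<in> carrier_vec N" using G P by simp
  ultimately show ?thesis using at_zeroI[of "G *\<^sub>v P"] by simp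
qed

section \<open>Polynomiality of the rescaled generators\<close>

lemma mprod_polynomial:
  fixes f :: "'x \<Rightarrow> 'k::field mat"
  assumes "\<And>x. x \<in> set xs \<Longrightarrow> f x \<in> carrier_mat N N"
  shows "\<exists>H\<in>carrier_mat N N. mprod N (\<lambda>x. map_mat const_Fz (f x)) xs = map_mat to_fract H"
  using assms
proof (induction xs)
  interpret fr: comm_ring_hom "to_fract :: 'k poly \<Rightarrow> 'k poly fract" by unfold_locales auto
  {
    case Nil
    show ?case
      by (intro bexI[of _ "1\<^sub>m N"]) (auto simp: mprod_def fr.mat_hom_one)
  next
    case (Cons x xs)
    then obtain H where H: "H \<in> carrier_mat N N" "mprod N (\<lambda>x. map_mat const_Fz (f x)) xs = map_mat to_fract H"
      by auto
    let ?f = "map_mat (\<lambda>c. [:c:]) (f x)"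
    have f: "?f \<in> carrier_mat N N" using Cons.prems by simp
    have "map_mat const_Fz (f x) = map_mat to_fract ?f"
      by (intro eq_matI) (auto simp: const_Fz_to_fract)
    then have "mprod N (\<lambda>x. map_mat const_Fz (f x)) (x # xs) = map_mat to_fract (?f * H)"
      using H(2) by (simp add: mprod_def fr.mat_hom_mult[OF f H(1)])
    then show ?case using f H(1) by (intro bexI[of _ "?f * H"]) auto
  }
qed

text \<open>This is where E_i' lying in U^(\<ge>0) enters: a word in the E_j and K_j^(+-1) is
  multiplied by a nonnegative power of z, so no denominators arise.\<close>

lemma eval_shift_polynomial:
  fixes Em Km Kinv :: "nat \<Rightarrow> 'k::field mat"
  assumes car: "\<forall>i\<le>n. Em i \<in> carrier_mat N N \<and> Km i \<in> carrier_mat N N \<and> Kinv i \<in> carrier_mat N N"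
    and "expr_in_Ihat n e"
  shows "\<exists>H\<in>carrier_mat N N. eval_shift N Em Km Kinv e = map_mat to_fract H"
  using assms(2)
proof (induction e)
  interpret fr: comm_ring_hom "to_fract :: 'k poly \<Rightarrow> 'k poly fract" by unfold_locales auto
  {
    case Nil
    show ?case
      by (intro bexI[of _ "0\<^sub>m N N"] eq_matI) (auto simp: eval_shift_def msum_def)
  next
    case (Cons cw e)
    obtain c w where cw: "cw = (c, w)" by force
    have "expr_in_Ihat n e" using Cons.prems by (simp add: expr_in_Ihat_def)
    then obtain H where H: "H \<in> carrier_mat N N" "eval_shift N Em Km Kinv e = map_mat to_fract H"
      using Cons.IH by blast
    have "gen_mat Em Km Kinv g \<in> carrier_mat N N" if "g \<in> set w" for g
    proof -
      have "gen_index g \<le> n" using Cons.prems that by (auto simp: expr_in_Ihat_def cw)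
      then show ?thesis using car by (cases g) auto
    qed
    then obtain H' where H': "H' \<in> carrier_mat N N"
        "mprod N (\<lambda>g. map_mat const_Fz (gen_mat Em Km Kinv g)) w = map_mat to_fract H'"
      using mprod_polynomial[of w "gen_mat Em Km Kinv" N] by blast
    let ?s = "[:c:] * [:0, 1:] ^ (\<Sum>g\<leftarrow>w. E_degree g)"
    have s: "const_Fz c * var_z ^ (\<Sum>g\<leftarrow>w. E_degree g) = to_fract ?s"
      by (simp only: const_Fz_to_fract var_z_to_fract fr.hom_mult fr.hom_power)
    have "eval_shift N Em Km Kinv (cw # e) =
        to_fract ?s \<cdot>\<^sub>m map_mat to_fract H' + map_mat to_fract H"
      using H(2) by (simp only: eval_shift_def msum_def cw foldr.simps o_apply prod.case H'(2) s)
    also have "\<dots> = map_mat to_fract (?s \<cdot>\<^sub>m H' + H)"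
      using H(1) H'(1) by (intro eq_matI) (simp_all only: index_map_mat index_add_mat index_smult_mat
          fr.hom_add fr.hom_mult carrier_matD)
    finally show ?case using H(1) H'(1) by (intro bexI[of _ "?s \<cdot>\<^sub>m H' + H"]) auto
  }
qed

text \<open>Multiplication by z turns z^(-1) F_i into F_i and leaves a factor z on the polynomial
  matrix of E_i', which disappears at z = 0.\<close>

lemma modified_F_shift_polynomial:
  fixes Em Fm Km Kinv :: "nat \<Rightarrow> 'k::field mat"
  assumes car: "\<forall>i\<le>n. Em i \<in> carrier_mat N N \<and> Km i \<in> carrier_mat N N \<and> Kinv i \<in> carrier_mat N N"
    and Fm: "Fm i \<in> carrier_mat N N" and "expr_in_Ihat n e"
  obtains G where "G \<in> carrier_mat N N"
    "map_mat to_fract G = var_z \<cdot>\<^sub>m modified_F_shift N Em Fm Km Kinv e i"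
    "map_mat (\<lambda>p. poly p 0) G = Fm i"
proof -
  obtain H where H: "H \<in> carrier_mat N N" "eval_shift N Em Km Kinv e = map_mat to_fract H"
    using eval_shift_polynomial[of n Em N Km Kinv e, OF car \<open>expr_in_Ihat n e\<close>] by blast
  define G where "G = map_mat (\<lambda>c. [:c:]) (Fm i) + [:0, 1:] \<cdot>\<^sub>m H"
  have "G \<in> carrier_mat N N" using Fm H(1) by (simp add: G_def)
  moreover have "map_mat to_fract G = var_z \<cdot>\<^sub>m modified_F_shift N Em Fm Km Kinv e i"
  proof (rule eq_matI)
    fix a b assume "a < dim_row (var_z \<cdot>\<^sub>m modified_F_shift N Em Fm Km Kinv e i)"
      "b < dim_col (var_z \<cdot>\<^sub>m modified_F_shift N Em Fm Km Kinv e i)"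
    then have ab: "a < N" "b < N" using H Fm by (auto simp: modified_F_shift_def)
    have "G $$ (a, b) = [:Fm i $$ (a, b):] + [:0, 1:] * H $$ (a, b)"
      using ab H(1) Fm by (simp add: G_def)
    then have "map_mat to_fract G $$ (a, b) = to_fract [:Fm i $$ (a, b):] + var_z * to_fract (H $$ (a, b))"
      using ab \<open>G \<in> carrier_mat N N\<close> by (simp only: index_map_mat carrier_matD to_fract_add to_fract_mult var_z_to_fract)
    also have "\<dots> = var_z * (inverse var_z * to_fract [:Fm i $$ (a, b):] + to_fract (H $$ (a, b)))"
      by (simp add: distrib_left mult.assoc[symmetric] right_inverse[OF var_z_nonzero])
    also have "\<dots> = (var_z \<cdot>\<^sub>m modified_F_shift N Em Fm Km Kinv e i) $$ (a, b)"
      using ab H Fm by (simp add: modified_F_shift_def const_Fz_to_fract)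
    finally show "map_mat to_fract G $$ (a, b) = (var_z \<cdot>\<^sub>m modified_F_shift N Em Fm Km Kinv e i) $$ (a, b)" .
  qed (use H Fm in \<open>auto simp: modified_F_shift_def G_def\<close>)
  moreover have "map_mat (\<lambda>p. poly p 0) G = Fm i"
    using H(1) Fm by (intro eq_matI) (auto simp: G_def)
  ultimately show ?thesis using that by blast
qed

text \<open>\<open>q\<close> is transcendental over the complex numbers, hence not a root of X or of
  X^k - 1; negative exponents reduce to positive ones by inversion.\<close>

lemma alg_closure_q_not_root:
  fixes q :: "'k::field"
  assumes "is_alg_closure_of_Cq \<iota> q"
  shows "q \<noteq> 0" and "\<And>m::int. q powi m = 1 \<Longrightarrow> m = 0"
proof -
  have add: "\<iota> (x + y) = \<iota> x + \<iota> y" and one: "\<iota> 1 = 1"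
    and tr: "p \<noteq> 0 \<Longrightarrow> poly (map_poly \<iota> p) q \<noteq> 0" for x y p
    using assms by (auto simp: is_alg_closure_of_Cq_def)
  have zero: "\<iota> 0 = 0" using add[of 0 0] by (metis add_0 add_cancel_right_left)
  have minus: "\<iota> (- 1) = - 1" using add[of 1 "- 1"] zero one by (simp add: eq_neg_iff_add_eq_0 add.commute)
  show q: "q \<noteq> 0"
    using tr[of "monom 1 1"] by (auto simp: map_poly_monom zero one poly_monom)
  have pow: "k = 0" if "q ^ k = 1" for k
  proof (rule ccontr)
    assume "k \<noteq> 0"
    then obtain l where l: "k = Suc l" by (cases k) auto
    \<comment> \<open>The polynomial is X^(l+1) - 1.\<close>
    have "poly (map_poly \<iota> (pCons (- 1) (monom 1 l))) q = 0"
      using that by (simp add: l map_poly_pCons map_poly_monom zero one minus poly_monom)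
    then show False using tr[of "pCons (- 1) (monom 1 l)"] by simp
  qed
  show "m = 0" if "q powi m = 1" for m :: int
  proof (cases "m \<ge> 0")
    case True
    then show ?thesis using that pow[of "nat m"] by (simp add: power_int_def)
  next
    case False
    then show ?thesis using that pow[of "nat (- m)"] by (simp add: power_int_def power_inverse)
  qed
qed

lemma modified_F_carrier:
  fixes Em Fm Km Kinv :: "nat \<Rightarrow> 'k::field mat"
  assumes "G \<in> carrier_mat N N" "map_mat to_fract G = var_z \<cdot>\<^sub>m modified_F_shift N Em Fm Km Kinv e i"
  shows "modified_F_shift N Em Fm Km Kinv e i \<in> carrier_mat N N"
  using arg_cong[OF assms(2), of dim_row] arg_cong[OF assms(2), of dim_col] assms(1) by auto

theorem theorem6p3:
  fixes \<iota> :: "complex \<Rightarrow> 'k::field" and q :: 'k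
    and n :: nat and A :: "nat \<Rightarrow> nat \<Rightarrow> int" and ahat :: "nat \<Rightarrow> nat \<Rightarrow> int"
    and d :: "nat \<Rightarrow> nat" and \<theta> :: "nat \<Rightarrow> int"
    and N :: nat and Em Fm Km Kinv :: "nat \<Rightarrow> 'k mat"
    and Eprime :: "nat \<Rightarrow> 'k geq0_expr"
  assumes "is_alg_closure_of_Cq \<iota> q"
    and "simple_cartan_matrix n A"
    and "is_highest_root n A \<theta>"
    and "symmetrizes {0..n} ahat d"
    and "untwisted_affine_ext n A d \<theta> ahat"
    and "is_UqLg_rep n ahat d \<theta> q N Em Fm Km Kinv"
    and "K_semisimple_qZ n q N Km"
    and "irreducible_action N (UqLg_gens n Em Fm Km Kinv)"
    and "\<forall>i\<in>{0..n}. expr_in_Ihat n (Eprime i)"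
  shows "irreducible_action N
           ((\<lambda>i. modified_F_shift N Em Fm Km Kinv (Eprime i) i) ` {0..n})"
proof -
  interpret quantum_loop_rep n ahat d \<theta> q N Em Fm Km Kinv
  proof
    show "q \<noteq> 0" "\<And>m::int. q powi m = 1 \<Longrightarrow> m = 0"
      using alg_closure_q_not_root[OF assms(1)] by blast+
    show "d i > 0" if "i \<le> n" for i
      using assms(4) that by (auto simp: symmetrizes_def)
    show "\<theta> i > 0" if "i \<in> {1..n}" for i
    proof -
      \<comment> \<open>The highest root dominates the simple root \<alpha>_i in every coordinate,
        so its i-th coefficient is at least 1.\<close>
      have "(if i = i then 1 else 0) \<le> \<theta> i"
        using assms(3) roots_of.simple[OF that, of A] that unfolding is_highest_root_def by fastforce
      then show ?thesis by simp
    qed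
    show "ahat i i = 2" if "i \<le> n" for i
      using assms(2,5) that
      by (cases "i = 0") (auto simp: untwisted_affine_ext_def simple_cartan_matrix_def is_GCM_on_def)
  qed (use assms in auto)
  let ?T = "\<lambda>i. modified_F_shift N Em Fm Km Kinv (Eprime i) i"
  have "\<exists>G. G \<in> carrier_mat N N \<and> map_mat to_fract G = var_z \<cdot>\<^sub>m ?T i \<and> map_mat (\<lambda>p. poly p 0) G = Fm i"
    if i: "i \<le> n" for i
  proof -
    have "expr_in_Ihat n (Eprime i)" using assms(9) i by simp
    moreover have "\<forall>i\<le>n. Em i \<in> carrier_mat N N \<and> Km i \<in> carrier_mat N N \<and> Kinv i \<in> carrier_mat N N"
      using carrier by simp
    ultimately show ?thesis
      using modified_F_shift_polynomial[of n Em N Km Kinv Fm i "Eprime i"] carrier(2)[OF i] by metis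
  qed
  then obtain G where G: "\<And>i. i \<le> n \<Longrightarrow> G i \<in> carrier_mat N N"
      "\<And>i. i \<le> n \<Longrightarrow> map_mat to_fract (G i) = var_z \<cdot>\<^sub>m ?T i"
      "\<And>i. i \<le> n \<Longrightarrow> map_mat (\<lambda>p. poly p 0) (G i) = Fm i"
    by metis
  have "W = {0\<^sub>v N} \<or> W = carrier_vec N"
    if W: "is_subspace N W" and stable: "\<forall>M\<in>gen_alg N (?T ` {0..n}). \<forall>w\<in>W. M *\<^sub>v w \<in> W" for W
  proof -
    have "Fm i *\<^sub>v v \<in> at_zero N W" if i: "i \<le> n" and v: "v \<in> at_zero N W" for i v
    proof -
      \<comment> \<open>\<open>G i\<close> acts as z times the i-th generator, and \<open>W\<close>
        is closed under scalars from F(z), so the rescaling preserves stability.\<close>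
      have "map_mat to_fract (G i) *\<^sub>v w \<in> W" if w: "w \<in> W" for w
      proof -
        have "?T i \<in> carrier_mat N N" "w \<in> carrier_vec N"
          using modified_F_carrier[OF G(1,2)[OF i]] w is_subspaceD(1)[OF W] by auto
        then have "map_mat to_fract (G i) *\<^sub>v w = var_z \<cdot>\<^sub>v (?T i *\<^sub>v w)"
          unfolding G(2)[OF i] by (intro eq_vecI) auto
        moreover have "?T i \<in> gen_alg N (?T ` {0..n})"
          using i by (intro gen_alg.gen) simp
        then have "?T i *\<^sub>v w \<in> W"
          using stable w by blast
        ultimately show ?thesis using is_subspaceD(4)[OF W] by simp
      qed
      then show ?thesis
        using at_zero_stable[OF G(1)[OF i] _ v] G(3)[OF i] by simp
    qed
    then have "at_zero N W = {0\<^sub>v N} \<or> at_zero N W = carrier_vec N"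
      by (intro F_irreducible_vec[OF assms(8) at_zero_subspace[OF W]])
    then show ?thesis
      using at_zero_nonzero[OF W] at_zero_eq_carrier[OF W] by blast
  qed
  moreover have "N > 0" using assms(8) by (simp add: irreducible_action_def)
  ultimately show ?thesis unfolding irreducible_action_def by blast
qed

end
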